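(* Let $(X,d,\mathfrak{m})$ be a metric measure space. Let $(d_i)_{i\in\mathbb{N}}$ be a sequence of complete distances on $X$ such that $d_i\nearrow d$ as $i\to\infty$ (that is, $d_i(x,y)\le d_{i+1}(x,y)$ for all $i$ and $\lim_{i\to\infty}d_i(x,y)=d(x,y)$, for all $x,y\in X$), and such that for every $i\in\mathbb{N}$ the distances $d_i$ and $d$ induce the same topology on $X$. Suppose that $(X,d_i,\mathfrak{m})$ is an infinitesimally Hilbertian metric measure space for every $i\in\mathbb{N}$. Then $(X,d,\mathfrak{m})$ is infinitesimally Hilbertian.
   Context: A metric measure space $(X,d,\mathfrak{m})$ is a complete separable metric space $(X,d)$ endowed with a Borel measure $\mathfrak{m}\ge 0$ that is boundedly finite, i.e. finite on $d$-bounded Borel sets. For a distance $d$ on $X$, let $\mathrm{LIP}_d(X)$ be the space of $d$-Lipschitz functions $f:X\to\mathbb{R}$. For $f\in\mathrm{LIP}_d(X)$ and $E\subseteq X$ set $$\mathrm{Lip}_d(f;E):=\sup\Big\{\tfrac{|f(x)-f(y)|}{d(x,y)}: x,y\in E,\ x\ne y\Big\},$$ with value $0$ if $E$ is empty or a singleton. The asymptotic slope is $\mathrm{lip}_a^d(f)(x):=\inf_{r>0}\mathrm{Lip}_d(f;B_r^d(x))$, $x\in X$, where $B_r^d(x)=\{y\in X: d(x,y)<r\}$. A function is boundedly-supported (with respect to $d$) if its support, the closure of $\{f\neq0\}$, is $d$-bounded. For a metric measure space $(X,d,\mathfrak{m})$, the asymptotic $2$-energy of a boundedly-supported $f\in\mathrm{LIP}_d(X)$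 is $\mathcal{E}_{a,2}^d(f):=\frac12\int \mathrm{lip}_a^d(f)^2\,d\mathfrak{m}$ (and $+\infty$ for all other elements of $L^2(\mathfrak{m})$). The Cheeger $2$-energy $\mathcal{E}_{\mathrm{Ch},2}^d:L^2(\mathfrak{m})\to[0,+\infty]$ is its $L^2(\mathfrak{m})$-lower semicontinuous envelope: $\mathcal{E}_{\mathrm{Ch},2}^d(f)$ is the infimum of $\liminf_{n\to\infty}\mathcal{E}_{a,2}^d(f_n)$ over all sequences $(f_n)_n\subseteq L^2(\mathfrak{m})$ with $f_n\to f$ strongly in $L^2(\mathfrak{m})$ (equivalently, over sequences of boundedly-supported $f_n\in\mathrm{LIP}_d(X)$, with the infimum of the empty set being $+\infty$). The Sobolev space is $W^{1,2}(X):=\{f\in L^2(\mathfrak{m}):\mathcal{E}_{\mathrm{Ch},2}^d(f)<+\infty\}$, a Banach space with norm $\|f\|_{W^{1,2}(X)}:=\big(\|f\|_{L^2(\mathfrak{m})}^2+2\,\mathcal{E}_{\mathrm{Ch},2}^d(f)\big)^{1/2}$. The metric measure space $(X,d,\mathfrak{m})$ is infinitesimally Hilbertian if $W^{1,2}(X)$ with this norm is a Hilbert space, or equivalently if $\mathcal{E}_{\mathrm{Ch},2}^d$ is a quadratic form, i.e. $\mathcal{E}_{\mathrm{Ch},2}^d(f+g)+\mathcal{E}_{\mathrm{Ch},2}^d(f-g)=2\mathcal{E}_{\mathrm{Ch},2}^d(f)+2\mathcal{E}_{\mathrm{Ch},2}^d(g)$ for all $f,g\in W^{1,2}(X)$.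 The same definitions apply to each metric measure space $(X,d_i,\mathfrak{m})$ (in particular, $\mathfrak{m}$ is finite on $d_i$-bounded sets). *)

theory Defs
  imports "HOL-Analysis.Analysis"
begin

locale metric_measure_space = Metric_space X d
  for X :: "'a set" and d :: "'a \<Rightarrow> 'a \<Rightarrow> real" +
  fixes m :: "'a measure"
  assumes complete: mcomplete
    and separable: "separable_space mtopology"
    and space_eq: "space m = X"
    and sets_eq: "sets m = sigma_sets X {U. openin mtopology U}"
    and boundedly_finite: "\<And>B. B \<in> sets m \<Longrightarrow> mbounded B \<Longrightarrow> emeasure m B < \<infinity>"

text \<open>
  Elements of L2 are represented by Borel functions; two functions that agree almost everywhere
  stand for the same element. Values outside the space are irrelevant throughout.
\<close>

definition L2 :: "'a measure \<Rightarrow> ('a \<Rightarrow> real) set"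
  where "L2 m = {f \<in> borel_measurable m. integrable m (\<lambda>x. (f x)\<^sup>2)}"

definition L2_norm :: "'a measure \<Rightarrow> ('a \<Rightarrow> real) \<Rightarrow> real"
  where "L2_norm m f = sqrt (\<integral>x. (f x)\<^sup>2 \<partial>m)"

text \<open>
  Hilbert space, for a vector space \<open>W\<close> of real functions with a norm \<open>N\<close>. The functions of norm
  zero are implicitly divided out, so the inner product is only required to be positive
  semidefinite on \<open>W\<close>, which follows from \<open>B f f = (N f)\<^sup>2\<close>.
\<close>

definition hilbert_space_on :: "('a \<Rightarrow> real) set \<Rightarrow> (('a \<Rightarrow> real) \<Rightarrow> real) \<Rightarrow> bool"
  where "hilbert_space_on W N \<longleftrightarrow>
    (\<lambda>x. 0) \<in> W \<and>
    (\<forall>f\<in>W. \<forall>g\<in>W. (\<lambda>x. f x + g x) \<in> W) \<and>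
    (\<forall>c. \<forall>f\<in>W. (\<lambda>x. c * f x) \<in> W) \<and>
    (\<exists>B :: ('a \<Rightarrow> real) \<Rightarrow> ('a \<Rightarrow> real) \<Rightarrow> real.
      (\<forall>f\<in>W. \<forall>g\<in>W. B f g = B g f) \<and>
      (\<forall>f\<in>W. \<forall>g\<in>W. \<forall>h\<in>W. B (\<lambda>x. f x + g x) h = B f h + B g h) \<and>
      (\<forall>c. \<forall>f\<in>W. \<forall>g\<in>W. B (\<lambda>x. c * f x) g = c * B f g) \<and>
      (\<forall>f\<in>W. B f f = (N f)\<^sup>2)) \<and>
    (\<forall>F :: nat \<Rightarrow> 'a \<Rightarrow> real. (\<forall>n. F n \<in> W) \<longrightarrow>
      (\<forall>e>0. \<exists>n0. \<forall>k\<ge>n0. \<forall>l\<ge>n0. N (\<lambda>x. F k x - F l x) < e) \<longrightarrow>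
      (\<exists>f\<in>W. (\<lambda>n. N (\<lambda>x. F n x - f x)) \<longlonglongrightarrow> 0))"

context metric_measure_space
begin

definition boundedly_supported :: "('a \<Rightarrow> real) \<Rightarrow> bool"
  where "boundedly_supported f \<longleftrightarrow> mbounded (mtopology closure_of {x \<in> X. f x \<noteq> 0})"

text \<open>In \<^typ>\<open>ennreal\<close> the supremum of the empty set is 0, as wanted if \<open>E\<close> is empty or a singleton.\<close>

definition Lip :: "('a \<Rightarrow> real) \<Rightarrow> 'a set \<Rightarrow> ennreal"
  where "Lip f E =
    (SUP (x, y) \<in> {(x, y). x \<in> E \<and> y \<in> E \<and> x \<noteq> y}. ennreal (\<bar>f x - f y\<bar> / d x y))"

definition asymptotic_slope :: "('a \<Rightarrow> real) \<Rightarrow> 'a \<Rightarrow> ennreal"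
  where "asymptotic_slope f x = (INF r \<in> {0<..}. Lip f (mball x r))"

text \<open>
  If \<open>m\<close> does not have full support, Lipschitz functions that agree almost everywhere can have
  different asymptotic energies. The energy is therefore a function of the representative, and the
  infimum in the Cheeger energy below runs over all representatives of the approximating sequence.
\<close>

definition asymptotic_energy :: "('a \<Rightarrow> real) \<Rightarrow> ennreal"
  where "asymptotic_energy f =
    (if Lipschitz_continuous_map Self euclidean_metric f \<and> boundedly_supported f
     then (\<integral>\<^sup>+x. (asymptotic_slope f x)\<^sup>2 \<partial>m) / 2 else \<infinity>)"

definition cheeger_energy :: "('a \<Rightarrow> real) \<Rightarrow> ennreal"
  where "cheeger_energy f =
    (INF F \<in> {F :: nat \<Rightarrow> 'a \<Rightarrow> real. (\<forall>n. F n \<in> L2 m) \<and>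
                (\<lambda>n. L2_norm m (\<lambda>x. F n x - f x)) \<longlonglongrightarrow> 0}.
       liminf (\<lambda>n. asymptotic_energy (F n)))"

definition W12 :: "('a \<Rightarrow> real) set"
  where "W12 = {f \<in> L2 m. cheeger_energy f < \<infinity>}"

definition W12_norm :: "('a \<Rightarrow> real) \<Rightarrow> real"
  where "W12_norm f = sqrt ((L2_norm m f)\<^sup>2 + 2 * enn2real (cheeger_energy f))"

end

locale infinitesimally_hilbertian = metric_measure_space +
  assumes hilbert: "hilbert_space_on W12 W12_norm"

end

theory Submission
  imports Defs
begin

text \<open>
  The proof passes the parallelogram law to the limit. Write \<open>Ch\<close> and \<open>Ch\<^sub>i\<close> for the Cheeger energies
  of \<open>d\<close> and \<open>d\<^sub>i\<close>. Enlarging a distance shrinks its balls and its difference quotients, so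
  \<open>Ch \<le> Ch\<^sub>j \<le> Ch\<^sub>i\<close> for \<open>i \<le> j\<close> (\<open>cheeger_le_asymptotic_energy\<close>, \<open>cheeger_mono\<close>). The point is the
  converse: every \<open>f\<close> with \<open>Ch f < \<infinity>\<close> is an \<open>L\<^sup>2\<close> limit of functions \<open>g\<close> with \<open>Ch\<^sub>i g \<le> Ch f + \<tau>\<close> for
  all large \<open>i\<close> (\<open>cheeger_recovery\<close>). Given this, apply the parallelogram law of \<open>Ch\<^sub>l\<close>, for one
  common large \<open>l\<close>, to approximations \<open>u\<close> of \<open>f\<close> and \<open>v\<close> of \<open>g\<close>; since \<open>Ch \<le> Ch\<^sub>l\<close> and \<open>Ch\<close> is lower
  semicontinuous, \<open>Ch (f + g) + Ch (f - g) \<le> 2 Ch f + 2 Ch g\<close>. Homogeneity is obtained in the same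
  way. The opposite inequality follows by substituting \<open>f + g\<close> and \<open>f - g\<close>, and the inner product by
  the Jordan-von Neumann argument; completeness of the Sobolev space is that of \<open>L\<^sup>2\<close> together with
  lower semicontinuity (\<open>hilbert_space_W12\<close>).

  For the recovery it is enough to treat an \<open>L\<close>-Lipschitz, boundedly supported \<open>f\<close> and its asymptotic
  energy. Such an \<open>f\<close> need not be \<open>d\<^sub>i\<close>-Lipschitz for any \<open>i\<close>, because \<open>d\<^sub>i\<close> may be much smaller than
  \<open>d\<close> at small scales, even where the two are uniformly close. It is replaced by a value function:
  \<open>u x\<close> is the infimum, over finite chains \<open>x\<^sub>0, \<dots>, x\<^sub>N = x\<close> with \<open>d\<^sub>i\<close>-steps at most \<open>\<delta>\<close> that start in
  a set \<open>S\<close>, of \<open>f x\<^sub>0 + (\<Sum>k<N. w x\<^sub>k * d\<^sub>i x\<^sub>k x\<^sub>k\<^sub>+\<^sub>1)\<close>. By construction the local \<open>d\<^sub>i\<close>-Lipschitz constant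
  of \<open>u\<close> is controlled by the weight \<open>w\<close>. The set \<open>S\<close> is a finite union of small \<open>d\<close>-balls carrying
  almost all of the measure in a bounded region; on \<open>S\<close> the weight is the Lipschitz constant of \<open>f\<close> in
  a ball of fixed small radius plus a small \<open>\<epsilon>\<close>, and off \<open>S\<close> it is the large constant \<open>4 L\<close>, which
  costs little energy. On \<open>S\<close> the function \<open>u\<close> stays close to \<open>f\<close>
  (\<open>chain_cost_invariant\<close>): a chain is cut into pieces with end points in \<open>S\<close> at \<open>d\<close>-distance at
  least a fixed \<open>r\<close>; for large \<open>i\<close> we have \<open>d \<le> d\<^sub>i + \<theta>\<close> on \<open>S\<close> with \<open>\<theta>\<close> much smaller than \<open>r\<close>, so that each piece
  pays for the increase of \<open>f\<close> along it, and the large weight pays for excursions outside \<open>S\<close>.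
  Truncating \<open>u\<close> gives it bounded support (\<open>chain_approximation\<close>), and a suitable choice of the
  parameters concludes (\<open>asymptotic_recovery\<close>).
\<close>

section \<open>The space of square integrable functions\<close>

lemma L2_measurable [measurable_dest]: "f \<in> L2 m \<Longrightarrow> f \<in> borel_measurable m"
  by (simp add: L2_def)

lemma L2_integrable: "f \<in> L2 m \<Longrightarrow> integrable m (\<lambda>x. (f x)\<^sup>2)"
  by (simp add: L2_def)

lemma power2_sum_le: "(a + b)\<^sup>2 \<le> 2 * a\<^sup>2 + 2 * (b::real)\<^sup>2"
  using zero_le_power2[of "a - b"] by (simp add: power2_eq_square algebra_simps)

lemma L2_add:
  assumes "f \<in> L2 m" "g \<in> L2 m"
  shows "(\<lambda>x. f x + g x) \<in> L2 m"
proof -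
  have "integrable m (\<lambda>x. (f x + g x)\<^sup>2)"
  proof (rule Bochner_Integration.integrable_bound)
    show "integrable m (\<lambda>x. 2 * (f x)\<^sup>2 + 2 * (g x)\<^sup>2)"
      using assms by (intro Bochner_Integration.integrable_add integrable_mult_right L2_integrable)
    show "(\<lambda>x. (f x + g x)\<^sup>2) \<in> borel_measurable m"
      using assms[THEN L2_measurable] by measurable
  qed (auto simp: power2_sum_le)
  then show ?thesis
    using assms[THEN L2_measurable] by (auto simp: L2_def)
qed

lemma L2_cmult: "f \<in> L2 m \<Longrightarrow> (\<lambda>x. c * f x) \<in> L2 m"
  by (auto simp: L2_def power_mult_distrib)

lemma L2_diff: "f \<in> L2 m \<Longrightarrow> g \<in> L2 m \<Longrightarrow> (\<lambda>x. f x - g x) \<in> L2 m"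
  using L2_add[of f m "\<lambda>x. -1 * g x"] L2_cmult[of g m "-1"] by simp

lemma L2_zero: "(\<lambda>x. 0) \<in> L2 m"
  by (simp add: L2_def)

lemma L2_norm_nonneg: "0 \<le> L2_norm m f"
  by (simp add: L2_norm_def)

lemma L2_norm_power2: "(L2_norm m f)\<^sup>2 = (\<integral>x. (f x)\<^sup>2 \<partial>m)"
  by (simp add: L2_norm_def)

lemma L2_norm_zero [simp]: "L2_norm m (\<lambda>x. 0) = 0"
  by (simp add: L2_norm_def)

lemma L2_norm_cmult: "L2_norm m (\<lambda>x. c * f x) = \<bar>c\<bar> * L2_norm m f"
  by (simp add: L2_norm_def power_mult_distrib real_sqrt_mult)

lemma L2_norm_minus_commute: "L2_norm m (\<lambda>x. f x - g x) = L2_norm m (\<lambda>x. g x - f x)"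
  by (simp add: L2_norm_def power2_commute)

lemma L2_norm_parallelogram:
  assumes "f \<in> L2 m" "g \<in> L2 m"
  shows "(L2_norm m (\<lambda>x. f x + g x))\<^sup>2 + (L2_norm m (\<lambda>x. f x - g x))\<^sup>2
    = 2 * (L2_norm m f)\<^sup>2 + 2 * (L2_norm m g)\<^sup>2"
proof -
  have "(\<integral>x. (f x + g x)\<^sup>2 \<partial>m) + (\<integral>x. (f x - g x)\<^sup>2 \<partial>m)
      = (\<integral>x. (f x + g x)\<^sup>2 + (f x - g x)\<^sup>2 \<partial>m)"
    using assms by (intro Bochner_Integration.integral_add[symmetric] L2_integrable L2_add L2_diff)
  also have "\<dots> = (\<integral>x. 2 * (f x)\<^sup>2 + 2 * (g x)\<^sup>2 \<partial>m)"
    by (simp add: power2_eq_square algebra_simps)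
  also have "\<dots> = 2 * (\<integral>x. (f x)\<^sup>2 \<partial>m) + 2 * (\<integral>x. (g x)\<^sup>2 \<partial>m)"
    using assms[THEN L2_integrable] by simp
  finally show ?thesis by (simp add: L2_norm_power2)
qed

text \<open>
  The factor 2 is what the parallelogram law gives at once; the estimate serves only to show that
  norms are small.
\<close>

lemma L2_norm_add_le:
  assumes "f \<in> L2 m" "g \<in> L2 m"
  shows "L2_norm m (\<lambda>x. f x + g x) \<le> 2 * (L2_norm m f + L2_norm m g)"
proof (rule power2_le_imp_le)
  have "(L2_norm m (\<lambda>x. f x + g x))\<^sup>2 \<le> 2 * (L2_norm m f)\<^sup>2 + 2 * (L2_norm m g)\<^sup>2"
    using L2_norm_parallelogram[OF assms] by (smt (verit) zero_le_power2)
  also have "\<dots> \<le> (2 * (L2_norm m f + L2_norm m g))\<^sup>2"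
    by (simp add: power2_eq_square algebra_simps L2_norm_nonneg)
  finally show "(L2_norm m (\<lambda>x. f x + g x))\<^sup>2 \<le> (2 * (L2_norm m f + L2_norm m g))\<^sup>2" .
qed (simp add: L2_norm_nonneg)

lemma L2_norm_triangle:
  assumes "f \<in> L2 m" "g \<in> L2 m" "h \<in> L2 m"
  shows "L2_norm m (\<lambda>x. f x - h x) \<le> 2 * (L2_norm m (\<lambda>x. f x - g x) + L2_norm m (\<lambda>x. g x - h x))"
  using L2_norm_add_le[OF L2_diff[OF assms(1,2)] L2_diff[OF assms(2,3)]] by simp

lemma nn_integral_square_L2:
  assumes "f \<in> L2 m"
  shows "(\<integral>\<^sup>+x. ennreal ((f x)\<^sup>2) \<partial>m) = ennreal ((L2_norm m f)\<^sup>2)"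
  using assms by (simp add: L2_norm_power2 nn_integral_eq_integral L2_integrable)

lemma L2_I_nn_integral:
  assumes [measurable]: "f \<in> borel_measurable m" and "(\<integral>\<^sup>+x. ennreal ((f x)\<^sup>2) \<partial>m) \<le> ennreal (c\<^sup>2)" "c \<ge> 0"
  shows "f \<in> L2 m" "L2_norm m f \<le> c"
proof -
  have "integrable m (\<lambda>x. (f x)\<^sup>2)"
    by (rule integrableI_nonneg) (use assms(2) in \<open>auto simp: top_unique less_top[symmetric]\<close>)
  then show L: "f \<in> L2 m" using assms by (simp add: L2_def)
  show "L2_norm m f \<le> c"
    using assms(2) \<open>c \<ge> 0\<close> unfolding nn_integral_square_L2[OF L]
    by (auto intro: power2_le_imp_le)
qed

lemma le_suminf_ennreal: "(g::nat \<Rightarrow> ennreal) n \<le> (\<Sum>n. g n)"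
  using sum_le_suminf[of g "{n}"] by simp

text \<open>
  The subsequence \<open>r\<close> has increments of norm at most \<open>4\<^sup>-\<^sup>n\<close>, so \<open>\<Sum>n. 4\<^sup>n * (D n)\<^sup>2\<close> is integrable. It is
  therefore finite almost everywhere, which forces \<open>\<bar>D n x\<bar>\<close> to decay like \<open>2\<^sup>-\<^sup>n\<close>, and the
  subsequence converges pointwise. Fatou's lemma turns this into convergence in norm.
\<close>

lemma L2_complete:
  assumes F: "\<And>n. F n \<in> L2 m"
    and Cauchy: "\<And>e. e > 0 \<Longrightarrow> \<exists>n0. \<forall>k\<ge>n0. \<forall>l\<ge>n0. L2_norm m (\<lambda>x. F k x - F l x) < e"
  shows "\<exists>f\<in>L2 m. (\<lambda>n. L2_norm m (\<lambda>x. F n x - f x)) \<longlonglongrightarrow> 0"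
proof -
  have [measurable]: "F n \<in> borel_measurable m" for n
    using F by (rule L2_measurable)
  define P where "P n N \<longleftrightarrow> (\<forall>k\<ge>N. \<forall>l\<ge>N. L2_norm m (\<lambda>x. F k x - F l x) < (1/4) ^ n)" for n N
  have exP: "\<exists>N. P n N" for n
    using Cauchy[of "(1/4) ^ n"] unfolding P_def by auto
  define r where "r = rec_nat (SOME N. P 0 N) (\<lambda>n N. max (Suc N) (SOME K. P (Suc n) K))"
  have rSuc: "r (Suc n) \<ge> Suc (r n)" for n by (simp add: r_def)
  have r_ge: "n \<le> r n" for n
    by (induction n) (use rSuc in \<open>auto intro: order_trans[rotated]\<close>)
  have rP: "P n (r n)" for n
  proof (cases n)
    case 0 then show ?thesis using someI_ex[OF exP, of 0] by (simp add: r_def)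
  next
    case (Suc k)
    have "P (Suc k) (SOME K. P (Suc k) K)" using someI_ex[OF exP] .
    then show ?thesis unfolding Suc by (auto simp: r_def P_def)
  qed
  define D where "D n x = F (r (Suc n)) x - F (r n) x" for n x
  have DL: "D n \<in> L2 m" for n unfolding D_def by (intro L2_diff F)
  have Dn: "L2_norm m (D n) \<le> (1/4) ^ n" for n
    using rP[of n] rSuc[of n] unfolding P_def D_def by (auto intro!: less_imp_le)
  have Dmeas [measurable]: "D n \<in> borel_measurable m" for n using DL by (rule L2_measurable)
  have "(\<integral>\<^sup>+x. (\<Sum>n. ennreal (4 ^ n * (D n x)\<^sup>2)) \<partial>m) = (\<Sum>n. \<integral>\<^sup>+x. ennreal (4 ^ n * (D n x)\<^sup>2) \<partial>m)"
    by (intro nn_integral_suminf) measurable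
  also have "\<dots> \<le> (\<Sum>n. ennreal ((1/4) ^ n))"
  proof (rule suminf_le)
    fix n
    have "(\<integral>\<^sup>+x. ennreal (4 ^ n * (D n x)\<^sup>2) \<partial>m) = ennreal (4 ^ n) * (\<integral>\<^sup>+x. ennreal ((D n x)\<^sup>2) \<partial>m)"
      by (subst nn_integral_cmult[symmetric]) (auto simp: ennreal_mult)
    also have "\<dots> = ennreal (4 ^ n * (L2_norm m (D n))\<^sup>2)"
      by (simp add: nn_integral_square_L2[OF DL] ennreal_mult)
    also have "\<dots> \<le> ennreal (4 ^ n * ((1/4) ^ n)\<^sup>2)"
      by (intro ennreal_leI mult_left_mono power_mono Dn L2_norm_nonneg) auto
    also have "(4::real) ^ n * ((1/4) ^ n)\<^sup>2 = (1/4) ^ n"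
      by (simp add: power2_eq_square power_one_over)
    finally show "(\<integral>\<^sup>+x. ennreal (4 ^ n * (D n x)\<^sup>2) \<partial>m) \<le> ennreal ((1/4) ^ n)" .
  qed auto
  also have "\<dots> < \<infinity>"
    by (subst suminf_ennreal2) (auto intro: summable_geometric)
  finally have fin: "(\<integral>\<^sup>+x. (\<Sum>n. ennreal (4 ^ n * (D n x)\<^sup>2)) \<partial>m) \<noteq> \<infinity>" by simp
  have AE: "AE x in m. (\<Sum>n. ennreal (4 ^ n * (D n x)\<^sup>2)) \<noteq> \<infinity>"
    by (rule nn_integral_PInf_AE[OF _ fin]) measurable
  have conv: "convergent (\<lambda>n. F (r n) x)" if S: "(\<Sum>n. ennreal (4 ^ n * (D n x)\<^sup>2)) \<noteq> \<infinity>" for x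
  proof -
    let ?S = "\<Sum>n. ennreal (4 ^ n * (D n x)\<^sup>2)"
    define c where "c = enn2real ?S"
    have c: "0 \<le> c" "?S = ennreal c"
      unfolding c_def using S by (simp_all only: enn2real_nonneg ennreal_enn2real infinity_ennreal_def less_top)
    have bnd: "\<bar>D n x\<bar> \<le> sqrt c * (1/2) ^ n" for n
    proof -
      have "ennreal (4 ^ n * (D n x)\<^sup>2) \<le> ennreal c"
        unfolding c(2)[symmetric] by (rule le_suminf_ennreal)
      then have "(2 ^ n * \<bar>D n x\<bar>)\<^sup>2 \<le> c"
        using c(1) by (simp add: ennreal_le_iff power_mult_distrib power_even_eq[symmetric] power_mult[symmetric] mult.commute[of n] power_mult[of 2 2])
      then have "2 ^ n * \<bar>D n x\<bar> \<le> sqrt c" by (rule real_le_rsqrt)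
      then show ?thesis by (simp add: field_simps power_one_over)
    qed
    have "summable (\<lambda>n. D n x)"
      by (rule summable_comparison_test'[where g = "\<lambda>n. sqrt c * (1/2) ^ n"])
        (use bnd in \<open>simp_all add: summable_mult summable_geometric\<close>)
    then have "convergent (\<lambda>N. \<Sum>n<N. D n x)" by (simp only: summable_iff_convergent)
    moreover have "(\<Sum>n<N. D n x) = F (r N) x - F (r 0) x" for N
      unfolding D_def by (rule sum_lessThan_telescope)
    ultimately have "convergent (\<lambda>N. F (r N) x - F (r 0) x)" by (simp only:)
    from convergent_add[OF this convergent_const[of "F (r 0) x"]] show ?thesis by (simp only: diff_add_cancel)
  qed
  define f where "f x = lim (\<lambda>n. F (r n) x)" for x
  have [measurable]: "f \<in> borel_measurable m"
    unfolding f_def by measurable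
  have lim: "AE x in m. (\<lambda>n. F (r n) x) \<longlonglongrightarrow> f x"
    using AE by eventually_elim (simp only: f_def conv convergent_LIMSEQ_iff[symmetric] simp_thms)
  \<comment> \<open>Fatou, applied along the subsequence for fixed \<open>k\<close>.\<close>
  have key: "(\<lambda>x. F k x - f x) \<in> L2 m \<and> L2_norm m (\<lambda>x. F k x - f x) \<le> e"
    if "e > 0" and n0: "\<forall>k\<ge>n0. \<forall>l\<ge>n0. L2_norm m (\<lambda>x. F k x - F l x) < e" and k: "k \<ge> n0" for e n0 k
  proof -
    have "(\<integral>\<^sup>+x. ennreal ((F k x - f x)\<^sup>2) \<partial>m)
        \<le> (\<integral>\<^sup>+x. liminf (\<lambda>n. ennreal ((F k x - F (r n) x)\<^sup>2)) \<partial>m)"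
    proof (rule nn_integral_mono_AE, use lim in eventually_elim)
      fix x assume "(\<lambda>n. F (r n) x) \<longlonglongrightarrow> f x"
      then have "(\<lambda>n. ennreal ((F k x - F (r n) x)\<^sup>2)) \<longlonglongrightarrow> ennreal ((F k x - f x)\<^sup>2)"
        by (intro tendsto_intros) auto
      then show "ennreal ((F k x - f x)\<^sup>2) \<le> liminf (\<lambda>n. ennreal ((F k x - F (r n) x)\<^sup>2))"
        by (metis lim_imp_Liminf order.refl sequentially_bot)
    qed
    also have "\<dots> \<le> liminf (\<lambda>n. \<integral>\<^sup>+x. ennreal ((F k x - F (r n) x)\<^sup>2) \<partial>m)"
      by (rule nn_integral_liminf) measurable
    also have "\<dots> = liminf (\<lambda>n. ennreal ((L2_norm m (\<lambda>x. F k x - F (r n) x))\<^sup>2))"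
      unfolding nn_integral_square_L2[OF L2_diff[OF F F]] ..
    also have "\<dots> \<le> ennreal (e\<^sup>2)"
    proof (rule Liminf_le)
      show "\<forall>\<^sub>F n in sequentially. ennreal ((L2_norm m (\<lambda>x. F k x - F (r n) x))\<^sup>2) \<le> ennreal (e\<^sup>2)"
        using eventually_ge_at_top[of n0]
      proof eventually_elim
        case (elim n)
        then have "r n \<ge> n0" using r_ge[of n] by simp
        then have "L2_norm m (\<lambda>x. F k x - F (r n) x) \<le> e"
          using n0 k by (auto intro: less_imp_le)
        then show ?case by (intro ennreal_leI power_mono L2_norm_nonneg)
      qed
    qed simp
    finally show ?thesis using L2_I_nn_integral[of "\<lambda>x. F k x - f x" m e] \<open>e > 0\<close> by simp
  qed
  obtain n1 where n1: "\<forall>k\<ge>n1. \<forall>l\<ge>n1. L2_norm m (\<lambda>x. F k x - F l x) < 1"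
    using Cauchy[of 1] by auto
  have "(\<lambda>x. F n1 x - (F n1 x - f x)) \<in> L2 m"
    by (rule L2_diff[OF F]) (use key[OF _ n1] in \<open>simp\<close>)
  then have fL: "f \<in> L2 m" by (simp only: diff_diff_eq2 add_diff_cancel_left')
  have "(\<lambda>n. L2_norm m (\<lambda>x. F n x - f x)) \<longlonglongrightarrow> 0"
  proof (rule LIMSEQ_I)
    fix e :: real assume "e > 0"
    then obtain n0 where n0: "\<forall>k\<ge>n0. \<forall>l\<ge>n0. L2_norm m (\<lambda>x. F k x - F l x) < e/2"
      using Cauchy[of "e/2"] by auto
    have "norm (L2_norm m (\<lambda>x. F n x - f x) - 0) < e" if "n \<ge> n0" for n
    proof -
      have "L2_norm m (\<lambda>x. F n x - f x) \<le> e/2" using key[OF _ n0 that] \<open>e > 0\<close> by simp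
      then show ?thesis using \<open>e > 0\<close> L2_norm_nonneg[of m "\<lambda>x. F n x - f x"] by simp
    qed
    then show "\<exists>no. \<forall>n\<ge>no. norm (L2_norm m (\<lambda>x. F n x - f x) - 0) < e" by blast
  qed
  with fL show ?thesis by blast
qed

section \<open>Inner products from the parallelogram law\<close>

text \<open>
  The deviation from linearity is additive and vanishes on the integers. It is then periodic,
  hence bounded everywhere, and an additive bounded function is zero.
\<close>

lemma additive_bounded_imp_linear:
  fixes p :: "real \<Rightarrow> real"
  assumes add: "\<And>a b. p (a + b) = p a + p b"
    and bound: "\<And>a. \<bar>a\<bar> \<le> 1 \<Longrightarrow> \<bar>p a\<bar> \<le> K"
  shows "p c = c * p 1"
proof -
  define s where "s a = p a - a * p 1" for a
  have s_add: "s (a + b) = s a + s b" for a b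
    by (simp add: s_def add algebra_simps)
  have s_mult: "s (of_nat n * a) = of_nat n * s a" for n a
  proof (induction n)
    case 0 show ?case using s_add[of 0 0] by simp
  next
    case (Suc n) then show ?case using s_add[of a "of_nat n * a"] by (simp add: algebra_simps)
  qed
  have s_minus: "s (- a) = - s a" for a
    using s_add[of a "- a"] s_add[of 0 0] by simp
  have s_int: "s (of_int k) = 0" for k
  proof (cases k rule: int_cases2)
    case (nonneg n) then show ?thesis using s_mult[of n 1] by (simp add: s_def)
  next
    case (nonpos n) then show ?thesis using s_mult[of n 1] s_minus[of "of_nat n"] by (simp add: s_def)
  qed
  have K: "\<bar>s a\<bar> \<le> K + \<bar>p 1\<bar>" for a
  proof -
    have "s a = s (frac a)"
      using s_add[of "frac a" "of_int \<lfloor>a\<rfloor>"] by (simp add: s_int frac_def)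
    moreover have "0 \<le> frac a" "frac a < 1" by (auto simp: frac_lt_1)
    moreover from this have "\<bar>frac a * p 1\<bar> \<le> 1 * \<bar>p 1\<bar>"
      unfolding abs_mult by (intro mult_right_mono) auto
    ultimately show ?thesis using bound[of "frac a"] by (simp add: s_def)
  qed
  have "s c = 0"
  proof (rule ccontr)
    assume "s c \<noteq> 0"
    then obtain n :: nat where "of_nat n * \<bar>s c\<bar> > K + \<bar>p 1\<bar>"
      using ex_less_of_nat_mult[of "\<bar>s c\<bar>"] by auto
    then show False using K[of "of_nat n * c"] by (simp add: s_mult abs_mult)
  qed
  then show ?thesis by (simp add: s_def)
qed

text \<open>
  The theorem of Jordan and von Neumann for a form \<open>q\<close> that may vanish outside 0. The polarization
  \<open>B\<close> is additive by the parallelogram law alone. For homogeneity over the reals continuity is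
  replaced by boundedness of \<open>c \<mapsto> B (c f) g\<close> for \<open>\<bar>c\<bar> \<le> 1\<close>, which follows from \<open>q \<ge> 0\<close>.
\<close>

lemma parallelogram_imp_bilinear:
  fixes W :: "('a \<Rightarrow> real) set" and q :: "('a \<Rightarrow> real) \<Rightarrow> real"
  assumes add: "\<And>f g. f \<in> W \<Longrightarrow> g \<in> W \<Longrightarrow> (\<lambda>x. f x + g x) \<in> W"
    and scale: "\<And>c f. f \<in> W \<Longrightarrow> (\<lambda>x. c * f x) \<in> W"
    and nonneg: "\<And>f. f \<in> W \<Longrightarrow> 0 \<le> q f"
    and hom: "\<And>c f. f \<in> W \<Longrightarrow> q (\<lambda>x. c * f x) = c\<^sup>2 * q f"
    and par: "\<And>f g. f \<in> W \<Longrightarrow> g \<in> W \<Longrightarrow>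
      q (\<lambda>x. f x + g x) + q (\<lambda>x. f x - g x) = 2 * q f + 2 * q g"
  shows "\<exists>B :: ('a \<Rightarrow> real) \<Rightarrow> ('a \<Rightarrow> real) \<Rightarrow> real.
      (\<forall>f\<in>W. \<forall>g\<in>W. B f g = B g f) \<and>
      (\<forall>f\<in>W. \<forall>g\<in>W. \<forall>h\<in>W. B (\<lambda>x. f x + g x) h = B f h + B g h) \<and>
      (\<forall>c. \<forall>f\<in>W. \<forall>g\<in>W. B (\<lambda>x. c * f x) g = c * B f g) \<and>
      (\<forall>f\<in>W. B f f = q f)"
proof -
  define B where "B f g = (q (\<lambda>x. f x + g x) - q (\<lambda>x. f x - g x)) / 4" for f g
  have minus: "q (\<lambda>x. - f x) = q f" if "f \<in> W" for f
    using hom[OF that, of "-1"] by simp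
  have diff: "(\<lambda>x. f x - g x) \<in> W" if "f \<in> W" "g \<in> W" for f g
    using add[OF that(1) scale[OF that(2), of "-1"]] by simp
  have sym: "B f g = B g f" if "f \<in> W" "g \<in> W" for f g
    using minus[OF diff[OF that]] by (simp add: B_def add.commute)
  have self: "B f f = q f" if "f \<in> W" for f
  proof -
    have "(\<lambda>x. f x + f x) = (\<lambda>x. 2 * f x)" "(\<lambda>x. f x - f x) = (\<lambda>x. 0 * f x)" by auto
    then show ?thesis
      unfolding B_def by (simp only: hom[OF that]) simp
  qed
  have half: "B f h + B g h = B (\<lambda>x. f x + g x) (\<lambda>x. 2 * h x) / 2"
    if "f \<in> W" "g \<in> W" "h \<in> W" for f g h
  proof -
    have "(\<lambda>x. f x + h x + (g x + h x)) = (\<lambda>x. f x + g x + 2 * h x)"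
      "(\<lambda>x. f x - h x + (g x - h x)) = (\<lambda>x. f x + g x - 2 * h x)"
      "(\<lambda>x. f x + h x - (g x + h x)) = (\<lambda>x. f x - g x)"
      "(\<lambda>x. f x - h x - (g x - h x)) = (\<lambda>x. f x - g x)"
      by auto
    then show ?thesis
      using par[OF add[OF that(1,3)] add[OF that(2,3)]] par[OF diff[OF that(1,3)] diff[OF that(2,3)]]
      unfolding B_def by (simp only:) argo
  qed
  have Badd: "B (\<lambda>x. f x + g x) h = B f h + B g h" if f: "f \<in> W" and g: "g \<in> W" and h: "h \<in> W" for f g h
  proof -
    have z: "(\<lambda>x. 0) \<in> W" using scale[OF h, of 0] by simp
    have "B (\<lambda>x. 0) h = 0" using minus[OF h] by (simp add: B_def)
    then have "B (\<lambda>x. f x + g x) h = B (\<lambda>x. f x + g x) (\<lambda>x. 2 * h x) / 2"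
      using half[OF add[OF f g] z h] by simp
    then show ?thesis using half[OF f g h] by simp
  qed
  have Bscale: "B (\<lambda>x. c * f x) g = c * B f g" if f: "f \<in> W" and g: "g \<in> W" for c f g
  proof -
    define p where "p c = B (\<lambda>x. c * f x) g" for c
    have "p (a + b) = p a + p b" for a b
      using Badd[OF scale[OF f, of a] scale[OF f, of b] g] by (simp add: p_def distrib_right)
    moreover have "\<bar>p a\<bar> \<le> q f + q g" if "\<bar>a\<bar> \<le> 1" for a
    proof -
      have "\<bar>p a\<bar> \<le> (q (\<lambda>x. a * f x + g x) + q (\<lambda>x. a * f x - g x)) / 4"
        using nonneg[OF add[OF scale[OF f] g], of a] nonneg[OF diff[OF scale[OF f] g], of a]
        by (auto simp: p_def B_def)
      also have "\<dots> = (a\<^sup>2 * q f + q g) / 2"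
        using par[OF scale[OF f] g, of a] by (simp add: hom[OF f])
      also have "a\<^sup>2 * q f \<le> 1 * q f"
        using that nonneg[OF f] by (intro mult_right_mono) (auto simp: abs_square_le_1)
      finally show ?thesis using nonneg[OF f] nonneg[OF g] by simp
    qed
    ultimately have "p c = c * p 1"
      by (rule additive_bounded_imp_linear)
    then show ?thesis by (simp add: p_def)
  qed
  show ?thesis
    by (intro exI[of _ B] conjI ballI allI) (simp_all add: self Badd Bscale, rule sym)
qed

lemma hilbert_space_on_parallelogram:
  assumes H: "hilbert_space_on W N" and f: "f \<in> W" and g: "g \<in> W"
  shows "(\<lambda>x. f x + g x) \<in> W" "(\<lambda>x. f x - g x) \<in> W" "(\<lambda>x. c * f x) \<in> W"
    and "(N (\<lambda>x. f x + g x))\<^sup>2 + (N (\<lambda>x. f x - g x))\<^sup>2 = 2 * (N f)\<^sup>2 + 2 * (N g)\<^sup>2"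
    and "(N (\<lambda>x. c * f x))\<^sup>2 = c\<^sup>2 * (N f)\<^sup>2"
proof -
  from H[unfolded hilbert_space_on_def, THEN conjunct2, THEN conjunct2, THEN conjunct2, THEN conjunct1]
  obtain B where B: "(\<forall>f\<in>W. \<forall>g\<in>W. B f g = B g f) \<and>
      (\<forall>f\<in>W. \<forall>g\<in>W. \<forall>h\<in>W. B (\<lambda>x. f x + g x) h = B f h + B g h) \<and>
      (\<forall>c. \<forall>f\<in>W. \<forall>g\<in>W. B (\<lambda>x. c * f x) g = c * B f g) \<and>
      (\<forall>f\<in>W. B f f = (N f)\<^sup>2)" by (elim exE) iprover
  have sym: "B f g = B g f" if "f \<in> W" "g \<in> W" for f g
    using B that by simp
  have Badd: "B (\<lambda>x. f x + g x) h = B f h + B g h" if "f \<in> W" "g \<in> W" "h \<in> W" for f g h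
    using B that by simp
  have Bscale: "B (\<lambda>x. c * f x) g = c * B f g" if "f \<in> W" "g \<in> W" for c f g
    using B that by simp
  have self: "B f f = (N f)\<^sup>2" if "f \<in> W" for f
    using B that by simp
  have add: "\<And>f g. f \<in> W \<Longrightarrow> g \<in> W \<Longrightarrow> (\<lambda>x. f x + g x) \<in> W"
    and scale: "\<And>c f. f \<in> W \<Longrightarrow> (\<lambda>x. c * f x) \<in> W"
    using H unfolding hilbert_space_on_def by blast+
  have square: "(N (\<lambda>x. a * f x + b * g x))\<^sup>2 = a\<^sup>2 * (N f)\<^sup>2 + 2 * a * b * B f g + b\<^sup>2 * (N g)\<^sup>2" for a b
  proof -
    note mem = f g scale[OF f, of a] scale[OF g, of b] add[OF scale[OF f, of a] scale[OF g, of b]]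
    have lin: "B (\<lambda>x. a * f x + b * g x) h = a * B f h + b * B g h" if "h \<in> W" for h
      using mem that by (simp add: Badd Bscale)
    let ?h = "\<lambda>x. a * f x + b * g x"
    have "(N ?h)\<^sup>2 = a * B f ?h + b * B g ?h"
      by (simp only: self[OF mem(5), symmetric] lin[OF mem(5)])
    also have "\<dots> = a * (a * B f f + b * B g f) + b * (a * B f g + b * B g g)"
      by (simp only: sym[OF f mem(5)] sym[OF g mem(5)] lin[OF f] lin[OF g])
    also have "\<dots> = a\<^sup>2 * (N f)\<^sup>2 + 2 * a * b * B f g + b\<^sup>2 * (N g)\<^sup>2"
      unfolding self[OF f] self[OF g] sym[OF g f] by (simp add: power2_eq_square algebra_simps)
    finally show ?thesis .
  qed
  show "(\<lambda>x. f x + g x) \<in> W" "(\<lambda>x. c * f x) \<in> W" by (intro add scale f g)+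
  show "(\<lambda>x. f x - g x) \<in> W" using add[OF f scale[OF g, of "-1"]] by simp
  show "(N (\<lambda>x. f x + g x))\<^sup>2 + (N (\<lambda>x. f x - g x))\<^sup>2 = 2 * (N f)\<^sup>2 + 2 * (N g)\<^sup>2"
    using square[of 1 1] square[of 1 "-1"] by simp
  show "(N (\<lambda>x. c * f x))\<^sup>2 = c\<^sup>2 * (N f)\<^sup>2"
    using square[of c 0] by simp
qed

section \<open>Local Lipschitz constants and the asymptotic slope\<close>

context metric_measure_space
begin

lemma openin_sets: "openin mtopology U \<Longrightarrow> U \<in> sets m"
  by (auto simp: sets_eq)

lemma Lipschitz_iff:
  "Lipschitz_continuous_map Self euclidean_metric f \<longleftrightarrow>
    (\<exists>L>0. \<forall>x\<in>X. \<forall>y\<in>X. \<bar>f x - f y\<bar> \<le> L * d x y)"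
  unfolding Lipschitz_continuous_map_pos by (simp add: dist_real_def)

lemma Lipschitz_measurable:
  assumes "\<And>x y. x \<in> X \<Longrightarrow> y \<in> X \<Longrightarrow> \<bar>f x - f y\<bar> \<le> L * d x y" "L > 0"
  shows "f \<in> borel_measurable m"
proof (rule borel_measurableI)
  fix S :: "real set" assume S: "open S"
  have "openin mtopology (f -` S \<inter> X)"
    unfolding openin_mtopology
  proof (intro conjI allI impI)
    fix x assume x: "x \<in> f -` S \<inter> X"
    then obtain e where e: "e > 0" "ball (f x) e \<subseteq> S" using S open_contains_ball by blast
    have "mball x (e / L) \<subseteq> f -` S \<inter> X"
    proof
      fix y assume y: "y \<in> mball x (e / L)"
      then have "\<bar>f x - f y\<bar> \<le> L * d x y" using assms by simp
      also have "\<dots> < e" using y \<open>L > 0\<close> by (simp add: field_simps)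
      finally show "y \<in> f -` S \<inter> X" using e y by (auto simp: dist_real_def)
    qed
    then show "\<exists>r>0. mball x r \<subseteq> f -` S \<inter> X" using e \<open>L > 0\<close> by (intro exI[of _ "e / L"]) simp
  qed auto
  then show "f -` S \<inter> space m \<in> sets m" by (simp add: space_eq openin_sets)
qed

lemma Lip_le:
  assumes "\<And>y z. y \<in> E \<Longrightarrow> z \<in> E \<Longrightarrow> \<bar>f y - f z\<bar> \<le> c * d y z" "E \<subseteq> X"
  shows "Lip f E \<le> ennreal c"
  unfolding Lip_def
proof (rule SUP_least, clarify)
  fix y z assume "y \<in> E" "z \<in> E" "y \<noteq> z"
  then have "0 < d y z" "\<bar>f y - f z\<bar> \<le> c * d y z" using assms by (auto simp: subset_iff)
  then show "ennreal (\<bar>f y - f z\<bar> / d y z) \<le> ennreal c"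
    by (intro ennreal_leI) (simp add: field_simps)
qed

lemma Lip_bound:
  assumes "Lip f E \<le> ennreal c" "y \<in> E" "z \<in> E" "E \<subseteq> X" "0 \<le> c"
  shows "\<bar>f y - f z\<bar> \<le> c * d y z"
proof (cases "y = z")
  case False
  have pos: "0 < d y z" using assms False by (auto simp: subset_iff)
  have "ennreal (\<bar>f y - f z\<bar> / d y z) \<le> Lip f E"
    unfolding Lip_def using assms False by (intro SUP_upper2[of "(y, z)"]) auto
  also note assms(1)
  finally have "\<bar>f y - f z\<bar> / d y z \<le> c" using \<open>0 \<le> c\<close> by (simp add: ennreal_le_iff)
  then show ?thesis using pos by (simp add: field_simps)
qed (use assms in auto)

lemma Lip_mono: "E \<subseteq> E' \<Longrightarrow> Lip f E \<le> Lip f E'"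
  unfolding Lip_def by (rule SUP_subset_mono) auto

lemma slope_le_Lip: "r > 0 \<Longrightarrow> asymptotic_slope f x \<le> Lip f (mball x r)"
  unfolding asymptotic_slope_def by (rule INF_lower) auto

lemma slope_le:
  assumes "r > 0" "\<And>y z. y \<in> mball x r \<Longrightarrow> z \<in> mball x r \<Longrightarrow> \<bar>f y - f z\<bar> \<le> c * d y z"
  shows "asymptotic_slope f x \<le> ennreal c"
  using order_trans[OF slope_le_Lip[OF assms(1)] Lip_le[OF assms(2) mball_subset_mspace]] .

text \<open>
  If two points witness that \<open>f\<close> has a large quotient in the ball around \<open>x\<close>, they do so for all
  centres near \<open>x\<close>: the superlevel sets are open.
\<close>

lemma Lip_ball_measurable: "(\<lambda>x. Lip f (mball x r)) \<in> borel_measurable m"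
proof (rule borel_measurableI_greater)
  fix c
  have "{x \<in> X. c < Lip f (mball x r)} =
      (\<Union>(y, z) \<in> {(y, z). y \<in> X \<and> z \<in> X \<and> y \<noteq> z \<and> c < ennreal (\<bar>f y - f z\<bar> / d y z)}. mball y r \<inter> mball z r)"
    by (auto simp: Lip_def less_SUP_iff commute) blast
  moreover have "openin mtopology \<dots>"
    by (intro openin_Union) auto
  ultimately show "{x \<in> space m. c < Lip f (mball x r)} \<in> sets m"
    by (simp add: space_eq openin_sets)
qed

lemma Lip_ball_LIMSEQ:
  "(\<lambda>n. Lip f (mball x (1 / Suc n))) \<longlonglongrightarrow> asymptotic_slope f x"
proof -
  have dec: "decseq (\<lambda>n. Lip f (mball x (1 / Suc n)))"
    by (rule decseq_SucI) (intro Lip_mono mball_subset_concentric, simp add: field_simps)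
  have "asymptotic_slope f x = (INF n. Lip f (mball x (1 / Suc n)))"
  proof (rule antisym)
    show "asymptotic_slope f x \<le> (INF n. Lip f (mball x (1 / Suc n)))"
      by (intro INF_greatest slope_le_Lip) simp
    show "(INF n. Lip f (mball x (1 / Suc n))) \<le> asymptotic_slope f x"
      unfolding asymptotic_slope_def
    proof (rule INF_greatest)
      fix r :: real assume "r \<in> {0<..}"
      then obtain n where "1 / Suc n < r" using nat_approx_posE[of r] by auto
      then show "(INF n. Lip f (mball x (1 / Suc n))) \<le> Lip f (mball x r)"
        by (intro INF_lower2[of n] Lip_mono mball_subset_concentric) auto
    qed
  qed
  then show ?thesis using LIMSEQ_INF[OF dec] by simp
qed

lemma slope_measurable [measurable]: "asymptotic_slope f \<in> borel_measurable m"
  by (rule borel_measurable_LIMSEQ_order[OF Lip_ball_LIMSEQ Lip_ball_measurable])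

section \<open>Relaxation and the Hilbert property\<close>

text \<open>
  Together with \<open>cheeger_leI\<close> this describes the sublevel sets of the Cheeger energy by single
  approximating functions in place of sequences and their inferior limits.
\<close>

lemma cheeger_approx:
  assumes "cheeger_energy f \<le> ennreal c" "0 \<le> c" "0 < e"
  obtains G where "G \<in> L2 m" "L2_norm m (\<lambda>x. G x - f x) < e" "asymptotic_energy G \<le> ennreal (c + e)"
proof -
  have "cheeger_energy f < ennreal (c + e)"
    using assms by (auto intro: le_less_trans simp: ennreal_less_iff)
  then obtain F where F: "\<And>n. F n \<in> L2 m" "(\<lambda>n. L2_norm m (\<lambda>x. F n x - f x)) \<longlonglongrightarrow> 0"
    "liminf (\<lambda>n. asymptotic_energy (F n)) < ennreal (c + e)"
    unfolding cheeger_energy_def INF_less_iff by auto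
  have "\<exists>\<^sub>F n in sequentially. asymptotic_energy (F n) < ennreal (c + e)"
  proof (rule ccontr)
    assume "\<not> ?thesis"
    then have "\<forall>\<^sub>F n in sequentially. ennreal (c + e) \<le> asymptotic_energy (F n)"
      by (simp add: not_frequently not_less)
    then have "ennreal (c + e) \<le> liminf (\<lambda>n. asymptotic_energy (F n))"
      by (rule Liminf_bounded)
    then show False using F(3) by simp
  qed
  moreover have "\<forall>\<^sub>F n in sequentially. L2_norm m (\<lambda>x. F n x - f x) < e"
    using order_tendstoD(2)[OF F(2) \<open>0 < e\<close>] .
  ultimately obtain n where "asymptotic_energy (F n) < ennreal (c + e)" "L2_norm m (\<lambda>x. F n x - f x) < e"
    using frequently_ex[OF frequently_eventually_frequently] by blast
  then show thesis using F(1) that[of "F n"] by simp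
qed

lemma cheeger_leI:
  assumes "0 \<le> c" and "\<And>e. 0 < e \<Longrightarrow> \<exists>G\<in>L2 m. L2_norm m (\<lambda>x. G x - f x) < e \<and>
      asymptotic_energy G \<le> ennreal (c + e)"
  shows "cheeger_energy f \<le> ennreal c"
proof -
  have "\<forall>n. \<exists>G. G \<in> L2 m \<and> L2_norm m (\<lambda>x. G x - f x) < 1 / Suc n \<and>
      asymptotic_energy G \<le> ennreal (c + 1 / Suc n)"
    using assms(2)[OF divide_pos_pos[OF zero_less_one of_nat_0_less_iff[THEN iffD2, OF zero_less_Suc]]]
    by (simp only: Bex_def) blast
  then obtain G where G: "\<And>n. G n \<in> L2 m" "\<And>n. L2_norm m (\<lambda>x. G n x - f x) < 1 / Suc n"
    "\<And>n. asymptotic_energy (G n) \<le> ennreal (c + 1 / Suc n)" using choice by metis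
  have "(\<lambda>n. L2_norm m (\<lambda>x. G n x - f x)) \<longlonglongrightarrow> 0"
    by (rule tendsto_sandwich[OF _ _ tendsto_const lim_inverse_n'[THEN LIMSEQ_Suc]])
      (simp_all only: L2_norm_nonneg less_imp_le[OF G(2)] eventually_True)
  then have "cheeger_energy f \<le> liminf (\<lambda>n. asymptotic_energy (G n))"
    unfolding cheeger_energy_def by (intro INF_lower) (simp add: G(1))
  also have "\<dots> \<le> liminf (\<lambda>n. ennreal (c + 1 / Suc n))"
    by (intro Liminf_mono always_eventually allI G(3))
  also have "\<dots> = ennreal c"
  proof (rule lim_imp_Liminf)
    have "(\<lambda>n. c + 1 / real (Suc n)) \<longlonglongrightarrow> c + 0"
      by (intro tendsto_add tendsto_const lim_inverse_n'[THEN LIMSEQ_Suc])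
    then show "(\<lambda>n. ennreal (c + 1 / Suc n)) \<longlonglongrightarrow> ennreal c" by (intro tendsto_ennrealI) simp
  qed simp
  finally show ?thesis .
qed

lemma cheeger_le_asymptotic:
  assumes "f \<in> L2 m" "asymptotic_energy f \<le> ennreal c" "0 \<le> c"
  shows "cheeger_energy f \<le> ennreal c"
  by (rule cheeger_leI[OF assms(3)])
    (use assms in \<open>auto intro!: bexI[of _ f] order_trans[OF assms(2)]\<close>)

lemma cheeger_lsc:
  assumes f: "f \<in> L2 m" and c: "0 \<le> c"
    and approx: "\<And>e. 0 < e \<Longrightarrow> \<exists>g\<in>L2 m. L2_norm m (\<lambda>x. g x - f x) < e \<and> cheeger_energy g \<le> ennreal (c + e)"
  shows "cheeger_energy f \<le> ennreal c"
proof (rule cheeger_leI[OF c])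
  fix e :: real assume e: "0 < e"
  then obtain g where g: "g \<in> L2 m" "L2_norm m (\<lambda>x. g x - f x) < e / 4" "cheeger_energy g \<le> ennreal (c + e / 4)"
    using approx[of "e / 4"] by auto
  obtain G where G: "G \<in> L2 m" "L2_norm m (\<lambda>x. G x - g x) < e / 4" "asymptotic_energy G \<le> ennreal (c + e / 4 + e / 4)"
    by (rule cheeger_approx[OF g(3), of "e / 4"]) (use c e in auto)
  have "L2_norm m (\<lambda>x. G x - f x) < e"
    using L2_norm_triangle[OF G(1) g(1) f] G(2) g(2) by simp
  moreover have "asymptotic_energy G \<le> ennreal (c + e)"
    using G(3) by (rule order_trans) (use e in \<open>auto intro!: ennreal_leI\<close>)
  ultimately show "\<exists>G\<in>L2 m. L2_norm m (\<lambda>x. G x - f x) < e \<and> asymptotic_energy G \<le> ennreal (c + e)"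
    using G(1) by blast
qed

lemma cheeger_energy_zero: "cheeger_energy (\<lambda>x. 0) = 0"
proof -
  have "asymptotic_slope (\<lambda>x. 0) x \<le> ennreal 0" for x
    by (rule slope_le[of 1]) auto
  then have "asymptotic_energy (\<lambda>x. 0) = 0"
    by (auto simp: asymptotic_energy_def Lipschitz_iff boundedly_supported_def intro!: exI[of _ 1])
  then show ?thesis using cheeger_le_asymptotic[OF L2_zero, of 0] by simp
qed

lemma W12_norm_power2: "(W12_norm f)\<^sup>2 = (L2_norm m f)\<^sup>2 + 2 * enn2real (cheeger_energy f)"
  by (simp add: W12_norm_def)

lemma W12D: "f \<in> W12 \<Longrightarrow> f \<in> L2 m" "f \<in> W12 \<Longrightarrow> cheeger_energy f = ennreal (enn2real (cheeger_energy f))"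
  by (auto simp: W12_def less_top)

lemma W12I: "f \<in> L2 m \<Longrightarrow> cheeger_energy f \<le> ennreal c \<Longrightarrow> f \<in> W12"
  by (auto simp: W12_def intro: le_less_trans)

text \<open>
  One-sided estimates suffice. Applying the first to \<open>c f\<close> with the factor \<open>1 / c\<close> and the second to
  \<open>f + g\<close> and \<open>f - g\<close> reverses them. For completeness, a Cauchy sequence has a limit in \<open>L\<^sup>2\<close>, and lower
  semicontinuity bounds the energy of \<open>F k - f\<close> by those of \<open>F k - F l\<close> with \<open>l\<close> large.
\<close>

lemma hilbert_space_W12:
  assumes hom: "\<And>c f. f \<in> W12 \<Longrightarrow> cheeger_energy (\<lambda>x. c * f x) \<le> ennreal (c\<^sup>2) * cheeger_energy f"
    and par: "\<And>f g. f \<in> W12 \<Longrightarrow> g \<in> W12 \<Longrightarrow>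
      cheeger_energy (\<lambda>x. f x + g x) + cheeger_energy (\<lambda>x. f x - g x)
        \<le> 2 * cheeger_energy f + 2 * cheeger_energy g"
  shows "hilbert_space_on W12 W12_norm"
proof -
  define E where "E f = enn2real (cheeger_energy f)" for f
  have E: "cheeger_energy f = ennreal (E f)" if "f \<in> W12" for f
    using W12D(2)[OF that] by (simp add: E_def)
  have E0: "0 \<le> E f" for f by (simp add: E_def)
  have scale: "(\<lambda>x. c * f x) \<in> W12" if f: "f \<in> W12" for c f
    using hom[OF f, of c] W12D(1)[OF f, THEN L2_cmult] E[OF f]
    by (intro W12I[where c = "c\<^sup>2 * E f"]) (auto simp: ennreal_mult E0)
  have bound: "cheeger_energy (\<lambda>x. f x + g x) + cheeger_energy (\<lambda>x. f x - g x) \<le> ennreal (2 * E f + 2 * E g)"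
    if "f \<in> W12" "g \<in> W12" for f g
    using par[OF that] by (simp add: E[OF that(1)] E[OF that(2)] ennreal_mult E0)
  have add: "(\<lambda>x. f x + g x) \<in> W12" if "f \<in> W12" "g \<in> W12" for f g
    by (rule W12I[OF L2_add[OF that[THEN W12D(1)]] order_trans[OF _ bound[OF that]]]) simp
  have diff: "(\<lambda>x. f x - g x) \<in> W12" if "f \<in> W12" "g \<in> W12" for f g
    by (rule W12I[OF L2_diff[OF that[THEN W12D(1)]] order_trans[OF _ bound[OF that]]]) simp
  have zero: "(\<lambda>x. 0) \<in> W12"
    by (rule W12I[OF L2_zero, of 0]) (simp add: cheeger_energy_zero)
  have hom_le: "E (\<lambda>x. c * f x) \<le> c\<^sup>2 * E f" if f: "f \<in> W12" for c f
    using hom[OF f, of c] by (simp add: E[OF f] E[OF scale[OF f]] E0 flip: ennreal_mult)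
  have Ehom: "E (\<lambda>x. c * f x) = c\<^sup>2 * E f" if f: "f \<in> W12" for c f
  proof (cases "c = 0")
    case False
    have "E f \<le> (1 / c)\<^sup>2 * E (\<lambda>x. c * f x)"
      using hom_le[OF scale[OF f], of "1 / c" c] False by simp
    then have "c\<^sup>2 * E f \<le> E (\<lambda>x. c * f x)" using False by (simp add: field_simps)
    with hom_le[OF f, of c] show ?thesis by simp
  qed (use hom_le[OF f, of 0] E0[of "\<lambda>x. 0"] in simp)
  have par_le: "E (\<lambda>x. f x + g x) + E (\<lambda>x. f x - g x) \<le> 2 * E f + 2 * E g"
    if "f \<in> W12" "g \<in> W12" for f g
    using bound[OF that] by (simp add: E[OF add[OF that]] E[OF diff[OF that]] E0 flip: ennreal_plus)
  have Epar: "E (\<lambda>x. f x + g x) + E (\<lambda>x. f x - g x) = 2 * E f + 2 * E g"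
    if "f \<in> W12" "g \<in> W12" for f g
  proof (rule antisym[OF par_le[OF that]])
    have "(\<lambda>x. f x + g x + (f x - g x)) = (\<lambda>x. 2 * f x)" "(\<lambda>x. f x + g x - (f x - g x)) = (\<lambda>x. 2 * g x)"
      by auto
    then show "2 * E f + 2 * E g \<le> E (\<lambda>x. f x + g x) + E (\<lambda>x. f x - g x)"
      using par_le[OF add[OF that] diff[OF that]] by (simp add: Ehom that)
  qed
  have Nq: "(W12_norm f)\<^sup>2 = (L2_norm m f)\<^sup>2 + 2 * E f" for f
    by (simp add: W12_norm_power2 E_def)
  have N0: "0 \<le> W12_norm f" for f
    by (simp add: W12_norm_def)
  have bilinear: "\<exists>B :: ('a \<Rightarrow> real) \<Rightarrow> ('a \<Rightarrow> real) \<Rightarrow> real.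
      (\<forall>f\<in>W12. \<forall>g\<in>W12. B f g = B g f) \<and>
      (\<forall>f\<in>W12. \<forall>g\<in>W12. \<forall>h\<in>W12. B (\<lambda>x. f x + g x) h = B f h + B g h) \<and>
      (\<forall>c. \<forall>f\<in>W12. \<forall>g\<in>W12. B (\<lambda>x. c * f x) g = c * B f g) \<and>
      (\<forall>f\<in>W12. B f f = (W12_norm f)\<^sup>2)"
  proof (rule parallelogram_imp_bilinear)
    show "(W12_norm (\<lambda>x. c * f x))\<^sup>2 = c\<^sup>2 * (W12_norm f)\<^sup>2" if "f \<in> W12" for c f
      unfolding Nq Ehom[OF that] L2_norm_cmult by (simp add: power_mult_distrib algebra_simps)
    show "(W12_norm (\<lambda>x. f x + g x))\<^sup>2 + (W12_norm (\<lambda>x. f x - g x))\<^sup>2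
        = 2 * (W12_norm f)\<^sup>2 + 2 * (W12_norm g)\<^sup>2" if "f \<in> W12" "g \<in> W12" for f g
      using L2_norm_parallelogram[OF that[THEN W12D(1)]] Epar[OF that] unfolding Nq by argo
  qed (simp_all add: add scale)
  have complete: "\<exists>f\<in>W12. (\<lambda>n. W12_norm (\<lambda>x. F n x - f x)) \<longlonglongrightarrow> 0"
    if F: "\<And>n. F n \<in> W12"
      and Cauchy: "\<And>e. 0 < e \<Longrightarrow> \<exists>n0. \<forall>k\<ge>n0. \<forall>l\<ge>n0. W12_norm (\<lambda>x. F k x - F l x) < e" for F
  proof -
    note FL = F[THEN W12D(1)]
    have L2_le: "L2_norm m g \<le> W12_norm g" for g
      by (rule power2_le_imp_le[OF _ N0]) (simp add: Nq E0)
    have "\<exists>n0. \<forall>k\<ge>n0. \<forall>l\<ge>n0. L2_norm m (\<lambda>x. F k x - F l x) < e" if "0 < e" for e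
      using Cauchy[OF that] L2_le le_less_trans by metis
    then obtain f where f: "f \<in> L2 m" and lim: "(\<lambda>n. L2_norm m (\<lambda>x. F n x - f x)) \<longlonglongrightarrow> 0"
      using L2_complete[where F = F and m = m, OF FL] by blast
    have energy: "cheeger_energy (\<lambda>x. F k x - f x) \<le> ennreal (e\<^sup>2)"
      if n0: "\<forall>k\<ge>n0. \<forall>l\<ge>n0. W12_norm (\<lambda>x. F k x - F l x) < e" and k: "k \<ge> n0" for e n0 k
    proof (rule cheeger_lsc)
      fix t :: real assume t: "0 < t"
      have "\<forall>\<^sub>F l in sequentially. L2_norm m (\<lambda>x. F l x - f x) < t \<and> l \<ge> n0"
        by (intro eventually_conj order_tendstoD(2)[OF lim t] eventually_ge_at_top)
      then obtain l where l: "L2_norm m (\<lambda>x. F l x - f x) < t" "l \<ge> n0"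
        using eventually_happens' sequentially_bot by blast
      have "(\<lambda>x. F k x - F l x - (F k x - f x)) = (\<lambda>x. f x - F l x)" by auto
      then have "L2_norm m (\<lambda>x. F k x - F l x - (F k x - f x)) < t"
        using l(1) by (simp add: L2_norm_minus_commute[of m f])
      moreover have "E (\<lambda>x. F k x - F l x) \<le> (W12_norm (\<lambda>x. F k x - F l x))\<^sup>2"
        using E0[of "\<lambda>x. F k x - F l x"] zero_le_power2[of "L2_norm m (\<lambda>x. F k x - F l x)"]
        unfolding Nq by linarith
      moreover have "(W12_norm (\<lambda>x. F k x - F l x))\<^sup>2 \<le> e\<^sup>2"
        using n0 k l(2) by (intro power_mono N0) (auto intro: less_imp_le)
      ultimately have "L2_norm m (\<lambda>x. F k x - F l x - (F k x - f x)) < t"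
        "E (\<lambda>x. F k x - F l x) \<le> e\<^sup>2 + t"
        using t by linarith+
      then show "\<exists>g\<in>L2 m. L2_norm m (\<lambda>x. g x - (F k x - f x)) < t \<and> cheeger_energy g \<le> ennreal (e\<^sup>2 + t)"
        by (intro bexI[OF _ L2_diff[OF FL[of k] FL[of l]]] conjI) (auto simp only: E[OF diff[OF F F]] intro!: ennreal_leI)
    qed (auto intro: L2_diff FL f)
    obtain n1 where n1: "\<forall>k\<ge>n1. \<forall>l\<ge>n1. W12_norm (\<lambda>x. F k x - F l x) < 1"
      using Cauchy[of 1] by auto
    have "(\<lambda>x. F n1 x - f x) \<in> W12"
      by (rule W12I[OF L2_diff[OF FL f] energy[OF n1 order.refl]])
    from diff[OF F this, of n1] have fW: "f \<in> W12" by (simp only: diff_diff_eq2 add_diff_cancel_left')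
    have "(\<lambda>n. E (\<lambda>x. F n x - f x)) \<longlonglongrightarrow> 0"
    proof (rule LIMSEQ_I)
      fix r :: real assume r: "0 < r"
      then obtain n0 where n0: "\<forall>k\<ge>n0. \<forall>l\<ge>n0. W12_norm (\<lambda>x. F k x - F l x) < sqrt (r / 2)"
        using Cauchy[of "sqrt (r / 2)"] by auto
      have "norm (E (\<lambda>x. F n x - f x) - 0) < r" if "n \<ge> n0" for n
        using energy[OF n0 that] r E0[of "\<lambda>x. F n x - f x"] by (simp add: E[OF diff[OF F fW]])
      then show "\<exists>no. \<forall>n\<ge>no. norm (E (\<lambda>x. F n x - f x) - 0) < r" by blast
    qed
    then have "(\<lambda>n. sqrt ((L2_norm m (\<lambda>x. F n x - f x))\<^sup>2 + 2 * E (\<lambda>x. F n x - f x))) \<longlonglongrightarrow> sqrt (0\<^sup>2 + 2 * 0)"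
      using lim by (intro tendsto_intros)
    then show ?thesis
      using fW by (intro bexI[of _ f]) (simp_all add: W12_norm_def E_def)
  qed
  show ?thesis
    unfolding hilbert_space_on_def
    by (intro conjI ballI allI impI zero add scale bilinear complete) auto
qed

end

section \<open>Monotonicity in the distance\<close>

text \<open>
  Truncation at a height that is a function itself, rather than multiplication by a cutoff: the local
  Lipschitz constant of the result is the maximum of those of the two functions, without a product
  term.
\<close>

definition clamp :: "real \<Rightarrow> real \<Rightarrow> real"
  where "clamp h a = max (- h) (min h a)"

lemma clamp_lipschitz: "\<bar>clamp h a - clamp h' a'\<bar> \<le> max \<bar>h - h'\<bar> \<bar>a - a'\<bar>"
  by (auto simp: clamp_def max_def min_def)

lemma clamp_zero: "clamp 0 a = 0" "0 \<le> h \<Longrightarrow> clamp h 0 = 0"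
  by (auto simp: clamp_def)

lemma clamp_id: "\<bar>a\<bar> \<le> h \<Longrightarrow> clamp h a = a"
  by (auto simp: clamp_def)

lemma abs_clamp_le: "0 \<le> h \<Longrightarrow> \<bar>clamp h a\<bar> \<le> \<bar>a\<bar>"
  by (auto simp: clamp_def)

lemma abs_clamp_diff_le: "0 \<le> h \<Longrightarrow> \<bar>clamp h a - a\<bar> \<le> \<bar>a\<bar>"
  by (auto simp: clamp_def)

context metric_measure_space
begin

lemma boundedly_supported_iff:
  assumes p: "p \<in> X"
  shows "boundedly_supported f \<longleftrightarrow> (\<exists>R>0. \<forall>x\<in>X. R < d p x \<longrightarrow> f x = 0)"
proof -
  have "boundedly_supported f \<longleftrightarrow> mbounded {x \<in> X. f x \<noteq> 0}"
    unfolding boundedly_supported_def by (intro mbounded_closure_of_eq) auto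
  also have "\<dots> \<longleftrightarrow> (\<exists>R>0. \<forall>x\<in>X. R < d p x \<longrightarrow> f x = 0)"
  proof
    assume "mbounded {x \<in> X. f x \<noteq> 0}"
    then have "mbounded (insert p {x \<in> X. f x \<noteq> 0})" using p by (simp add: mbounded_insert)
    then obtain B where B: "B > 0" "\<And>x. x \<in> X \<Longrightarrow> f x \<noteq> 0 \<Longrightarrow> d p x \<le> B"
      unfolding mbounded_alt_pos by auto
    then show "\<exists>R>0. \<forall>x\<in>X. R < d p x \<longrightarrow> f x = 0" by (meson not_le)
  next
    assume "\<exists>R>0. \<forall>x\<in>X. R < d p x \<longrightarrow> f x = 0"
    then obtain R where "\<forall>x\<in>X. R < d p x \<longrightarrow> f x = 0" by blast
    then have "{x \<in> X. f x \<noteq> 0} \<subseteq> mcball p R" using p by (auto simp: not_less[symmetric])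
    then show "mbounded {x \<in> X. f x \<noteq> 0}" unfolding mbounded_def by blast
  qed
  finally show ?thesis .
qed

lemma mcball_sets [measurable]: "mcball p R \<in> sets m"
proof -
  have "X - (X - mcball p R) \<in> sets m"
    by (intro sets.Diff openin_sets openin_diff) auto
  moreover have "X - (X - mcball p R) = mcball p R" by auto
  ultimately show ?thesis by simp
qed

lemma emeasure_mcball_finite: "emeasure m (mcball p R) < \<infinity>"
  by (intro boundedly_finite mcball_sets mbounded_mcball)

text \<open>
  Finite asymptotic energy in terms of a base point; a Lipschitz function vanishing outside a ball is
  bounded.
\<close>

lemma asymptotic_energy_finiteE:
  assumes "asymptotic_energy f < \<infinity>" "p \<in> X"
  obtains L R C where "0 < L" "0 < R" "0 < C"
    "\<And>x y. x \<in> X \<Longrightarrow> y \<in> X \<Longrightarrow> \<bar>f x - f y\<bar> \<le> L * d x y"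
    "\<And>x. x \<in> X \<Longrightarrow> R < d p x \<Longrightarrow> f x = 0"
    "\<And>x. x \<in> X \<Longrightarrow> \<bar>f x\<bar> \<le> C"
    "asymptotic_energy f = (\<integral>\<^sup>+x. (asymptotic_slope f x)\<^sup>2 \<partial>m) / 2"
proof -
  have lip: "Lipschitz_continuous_map Self euclidean_metric f" and supp: "boundedly_supported f"
    using assms(1) by (auto simp: asymptotic_energy_def split: if_splits)
  obtain L where L: "0 < L" "\<And>x y. x \<in> X \<Longrightarrow> y \<in> X \<Longrightarrow> \<bar>f x - f y\<bar> \<le> L * d x y"
    using lip unfolding Lipschitz_iff by blast
  obtain R where R: "0 < R" "\<And>x. x \<in> X \<Longrightarrow> R < d p x \<Longrightarrow> f x = 0"
    using supp unfolding boundedly_supported_iff[OF assms(2)] by blast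
  have C: "\<bar>f x\<bar> \<le> \<bar>f p\<bar> + L * R" if x: "x \<in> X" for x
  proof (cases "R < d p x")
    case False
    have "\<bar>f p - f x\<bar> \<le> L * d p x" using L(2) assms(2) x by simp
    also have "\<dots> \<le> L * R" using False L(1) by simp
    finally show ?thesis by linarith
  qed (use R(2) x \<open>0 < R\<close> L(1) in simp)
  show thesis
    by (rule that[OF L(1) R(1) _ L(2) R(2) C])
      (use L R lip supp in \<open>auto simp: asymptotic_energy_def intro: add_nonneg_pos\<close>)
qed

lemma L2_bounded_support:
  assumes "f \<in> borel_measurable m" "\<And>x. x \<in> X \<Longrightarrow> \<bar>f x\<bar> \<le> C" "\<And>x. x \<in> X \<Longrightarrow> R < d p x \<Longrightarrow> f x = 0" "p \<in> X"
  shows "f \<in> L2 m"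
proof -
  have "integrable m (\<lambda>x. (f x)\<^sup>2)"
  proof (rule Bochner_Integration.integrable_bound)
    show "integrable m (\<lambda>x. C\<^sup>2 * indicator (mcball p R) x)"
      using emeasure_mcball_finite by (intro integrable_mult_right integrable_real_indicator) auto
    show "AE x in m. norm ((f x)\<^sup>2) \<le> norm (C\<^sup>2 * indicator (mcball p R) x)"
    proof (rule AE_I2)
      fix x assume "x \<in> space m"
      then have x: "x \<in> X" by (simp add: space_eq)
      then have "(f x)\<^sup>2 \<le> C\<^sup>2" using assms(2)[OF x] by (simp add: abs_le_square_iff[symmetric])
      then show "norm ((f x)\<^sup>2) \<le> norm (C\<^sup>2 * indicator (mcball p R) x)"
        using assms(3)[OF x] x \<open>p \<in> X\<close> by (auto simp: indicator_def)
    qed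
  qed (use assms(1) in measurable)
  then show ?thesis using assms(1) by (simp add: L2_def)
qed

lemma asymptotic_energy_eq:
  assumes "\<And>x y. x \<in> X \<Longrightarrow> y \<in> X \<Longrightarrow> \<bar>f x - f y\<bar> \<le> L * d x y" "0 < L"
    "\<And>x. x \<in> X \<Longrightarrow> R < d p x \<Longrightarrow> f x = 0" "0 < R" "p \<in> X"
  shows "asymptotic_energy f = (\<integral>\<^sup>+x. (asymptotic_slope f x)\<^sup>2 \<partial>m) / 2"
proof -
  have "Lipschitz_continuous_map Self euclidean_metric f" "boundedly_supported f"
    using assms unfolding Lipschitz_iff boundedly_supported_iff[OF assms(5)] by blast+
  then show ?thesis by (simp add: asymptotic_energy_def)
qed

lemma asymptotic_energy_empty:
  assumes "X = {}"
  shows "asymptotic_energy f = 0"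
proof -
  have "Lipschitz_continuous_map Self euclidean_metric f"
    unfolding Lipschitz_iff using assms by (intro exI[of _ 1]) simp
  moreover have "boundedly_supported f"
  proof -
    have "{x \<in> X. f x \<noteq> 0} = {}" using assms by blast
    then show ?thesis by (simp only: boundedly_supported_def closure_of_empty mbounded_empty)
  qed
  moreover have "(\<integral>\<^sup>+x. (asymptotic_slope f x)\<^sup>2 \<partial>m) = 0"
    by (rule nn_integral_empty) (simp only: space_eq assms)
  ultimately show ?thesis
    by (simp add: asymptotic_energy_def)
qed

end

text \<open>
  The letter \<open>e\<close> denotes the smaller distance, hence the one with the larger Cheeger energy.
\<close>

locale comparable_metrics =
  D: metric_measure_space X d m + E: metric_measure_space X e m
  for X :: "'a set" and d e :: "'a \<Rightarrow> 'a \<Rightarrow> real" and m :: "'a measure" +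
  assumes le: "x \<in> X \<Longrightarrow> y \<in> X \<Longrightarrow> e x y \<le> d x y"
begin

lemma slope_clamp_le:
  assumes r: "0 < r" and h: "\<And>y z. y \<in> X \<Longrightarrow> z \<in> X \<Longrightarrow> \<bar>h y - h z\<bar> \<le> r * d y z"
  shows "D.asymptotic_slope (\<lambda>x. clamp (h x) (f x)) x \<le> max (E.asymptotic_slope f x) (ennreal r)"
proof (rule dense_ge)
  fix c assume c: "max (E.asymptotic_slope f x) (ennreal r) < c"
  show "D.asymptotic_slope (\<lambda>x. clamp (h x) (f x)) x \<le> c"
  proof (cases c)
    case (real c')
    obtain s where s: "0 < s" "E.Lip f (E.mball x s) < c"
      using c unfolding E.asymptotic_slope_def by (auto simp: INF_less_iff)
    have c': "r < c'" using c real by (auto simp: ennreal_less_iff r less_imp_le)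
    have "D.asymptotic_slope (\<lambda>x. clamp (h x) (f x)) x \<le> ennreal c'"
    proof (rule D.slope_le[OF s(1)])
      fix y z assume yz: "y \<in> D.mball x s" "z \<in> D.mball x s"
      then have mem: "y \<in> X" "z \<in> X" by auto
      have "y \<in> E.mball x s" "z \<in> E.mball x s"
        using yz le[of x y] le[of x z] by auto
      then have "\<bar>f y - f z\<bar> \<le> c' * e y z"
        using s(2) real by (intro E.Lip_bound[of f "E.mball x s"]) auto
      also have "\<dots> \<le> c' * d y z" using real mem by (intro mult_left_mono le) auto
      finally have "\<bar>f y - f z\<bar> \<le> c' * d y z" .
      moreover have "\<bar>h y - h z\<bar> \<le> c' * d y z"
        using h[OF mem] mult_right_mono[OF less_imp_le[OF c'] D.nonneg, of y z] by linarith
      ultimately show "\<bar>clamp (h y) (f y) - clamp (h z) (f z)\<bar> \<le> c' * d y z"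
        using clamp_lipschitz[of "h y" "f y" "h z" "f z"] by linarith
    qed
    then show ?thesis using real by simp
  qed simp
qed

text \<open>
  A function with \<open>e\<close>-bounded support has no larger slope for \<open>d\<close>, but its support may fail to be
  \<open>d\<close>-bounded. Truncating it at heights \<open>h n\<close> with slope \<open>1 / (n + 1)\<close> that tend to infinity makes the
  support \<open>d\<close>-bounded. This adds at most \<open>1 / (n + 1)\<^sup>2\<close> to the squared slope, and only on the
  original support, whose measure is finite because it is \<open>e\<close>-bounded.
\<close>

lemma cheeger_le_asymptotic_energy:
  assumes F: "F \<in> L2 m" and c: "0 \<le> c" "E.asymptotic_energy F \<le> ennreal c"
  shows "D.cheeger_energy F \<le> ennreal c"
proof (cases "X = {}")
  case True
  show ?thesis
    by (rule D.cheeger_le_asymptotic[OF F _ c(1)]) (simp add: D.asymptotic_energy_empty[OF True])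
next
  case False
  then obtain p where p: "p \<in> X" by blast
  have "E.asymptotic_energy F < \<infinity>" using c(2) by (rule le_less_trans) simp
  then obtain L R C where L: "0 < L" and R: "0 < R" and C: "0 < C"
    and lip: "\<And>x y. x \<in> X \<Longrightarrow> y \<in> X \<Longrightarrow> \<bar>F x - F y\<bar> \<le> L * e x y"
    and supp: "\<And>x. x \<in> X \<Longrightarrow> R < e p x \<Longrightarrow> F x = 0"
    and bound: "\<And>x. x \<in> X \<Longrightarrow> \<bar>F x\<bar> \<le> C"
    and energy: "E.asymptotic_energy F = (\<integral>\<^sup>+x. (E.asymptotic_slope F x)\<^sup>2 \<partial>m) / 2"
    using E.asymptotic_energy_finiteE[OF _ p] by metis
  \<comment> \<open>Height \<open>n + 1\<close> at \<open>p\<close> and slope \<open>1 / (n + 1)\<close>, so \<open>h n\<close> vanishes beyond distance \<open>(n + 1)\<^sup>2\<close>.\<close>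
  define h where "h n x = max 0 (real (Suc n) - d p x / real (Suc n))" for n x
  define G where "G n x = clamp (h n x) (F x)" for n x
  have hlip: "\<bar>h n x - h n y\<bar> \<le> (1 / Suc n) * d x y" if "x \<in> X" "y \<in> X" for n x y
  proof -
    have "\<bar>d p x - d p y\<bar> \<le> d x y"
      using D.mdist_reverse_triangle[OF that(1) p that(2)] by (simp add: D.commute)
    then have "\<bar>d p x / Suc n - d p y / Suc n\<bar> \<le> d x y / Suc n"
      by (simp add: diff_divide_distrib[symmetric] divide_right_mono)
    then show ?thesis unfolding h_def by (auto simp: max_def)
  qed
  have Glip: "\<bar>G n x - G n y\<bar> \<le> (L + 1 / Suc n) * d x y" if "x \<in> X" "y \<in> X" for n x y
  proof -
    have "\<bar>F x - F y\<bar> \<le> L * d x y"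
      using lip[OF that] mult_left_mono[OF le[OF that] less_imp_le[OF L]] by linarith
    moreover have "0 \<le> L * d x y" "0 \<le> 1 / real (Suc n) * d x y" using L by auto
    ultimately show ?thesis
      using clamp_lipschitz[of "h n x" "F x" "h n y" "F y"] hlip[OF that, of n]
      unfolding G_def distrib_right by linarith
  qed
  have Gsupp: "G n x = 0" if "x \<in> X" "(real (Suc n))\<^sup>2 < d p x" for n x
  proof -
    have "real (Suc n) \<le> d p x / real (Suc n)"
      using less_imp_le[OF that(2)] by (simp add: pos_le_divide_eq power2_eq_square del: of_nat_Suc)
    then show ?thesis by (simp add: G_def h_def clamp_zero)
  qed
  have Genergy: "D.asymptotic_energy (G n) = (\<integral>\<^sup>+x. (D.asymptotic_slope (G n) x)\<^sup>2 \<partial>m) / 2" for n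
    by (rule D.asymptotic_energy_eq[where R = "(real (Suc n))\<^sup>2", OF Glip _ Gsupp _ p])
      (use L in \<open>auto intro: add_pos_pos\<close>)
  have GL: "G n \<in> L2 m" for n
  proof (rule D.L2_bounded_support[where R = "(real (Suc n))\<^sup>2", OF _ _ Gsupp p])
    show "G n \<in> borel_measurable m"
      by (rule D.Lipschitz_measurable[OF Glip]) (use L in \<open>auto intro: add_pos_pos\<close>)
    show "\<bar>G n x\<bar> \<le> C" if "x \<in> X" for x
      using abs_clamp_le[of "h n x" "F x"] bound[OF that] unfolding G_def h_def by simp
  qed
  have Gslope: "(D.asymptotic_slope (G n) x)\<^sup>2
      \<le> (E.asymptotic_slope F x)\<^sup>2 + ennreal ((1 / Suc n)\<^sup>2) * indicator (E.mcball p R) x"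
    if x: "x \<in> X" for n x
  proof (cases "x \<in> E.mcball p R")
    case True
    have "D.asymptotic_slope (G n) x \<le> max (E.asymptotic_slope F x) (ennreal (1 / Suc n))"
      unfolding G_def by (rule slope_clamp_le[OF _ hlip]) simp
    then have "(D.asymptotic_slope (G n) x)\<^sup>2 \<le> (max (E.asymptotic_slope F x) (ennreal (1 / Suc n)))\<^sup>2"
      by (rule power_mono) simp
    also have "\<dots> \<le> (E.asymptotic_slope F x)\<^sup>2 + (ennreal (1 / Suc n))\<^sup>2"
      by (cases "E.asymptotic_slope F x" "ennreal (1 / Suc n)" rule: linorder_le_cases) (simp_all add: max_def)
    finally show ?thesis using True by (simp add: ennreal_power del: of_nat_Suc)
  next
    case False
    have "D.asymptotic_slope (G n) x \<le> ennreal 0"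
    proof (rule D.slope_le)
      show "0 < e p x - R" using False x p by auto
      have "G n y = 0" if "y \<in> D.mball x (e p x - R)" for y
      proof -
        have y: "y \<in> X" "d x y < e p x - R" using that by auto
        have "e p x \<le> e p y + e y x" using E.triangle[OF p y(1) x] .
        then have "F y = 0" using supp[OF y(1)] le[OF x y(1)] y(2) by (simp add: E.commute)
        then show ?thesis by (simp add: G_def h_def clamp_zero)
      qed
      then show "\<bar>G n y - G n z\<bar> \<le> 0 * d y z"
        if "y \<in> D.mball x (e p x - R)" "z \<in> D.mball x (e p x - R)" for y z
        using that by simp
    qed
    then show ?thesis by simp
  qed
  define \<mu> where "\<mu> = measure m (E.mcball p R)"
  have \<mu>: "emeasure m (E.mcball p R) = ennreal \<mu>" "0 \<le> \<mu>"
    using E.emeasure_mcball_finite[of p R] by (auto simp: \<mu>_def emeasure_eq_ennreal_measure less_top)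
  have Genergy_le: "D.asymptotic_energy (G n) \<le> ennreal (c + (1 / Suc n)\<^sup>2 * \<mu>)" for n
  proof -
    let ?r = "(1 / real (Suc n))\<^sup>2"
    have "(\<integral>\<^sup>+x. (D.asymptotic_slope (G n) x)\<^sup>2 \<partial>m)
        \<le> (\<integral>\<^sup>+x. (E.asymptotic_slope F x)\<^sup>2 + ennreal ?r * indicator (E.mcball p R) x \<partial>m)"
      by (rule nn_integral_mono) (use Gslope in \<open>simp only: D.space_eq\<close>)
    also have "\<dots> = (\<integral>\<^sup>+x. (E.asymptotic_slope F x)\<^sup>2 \<partial>m) + ennreal ?r * emeasure m (E.mcball p R)"
      by (subst nn_integral_add) (auto simp: nn_integral_cmult_indicator)
    finally have "D.asymptotic_energy (G n) \<le> E.asymptotic_energy F + ennreal (?r * \<mu>) / 2"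
      unfolding Genergy energy \<mu>(1) add_divide_distrib_ennreal[symmetric]
      by (intro divide_right_mono_ennreal) (simp only: ennreal_mult[OF zero_le_power2 \<mu>(2)])
    also have "\<dots> \<le> ennreal c + ennreal (?r * \<mu>)"
      by (intro add_mono c(2) divide_le_posI_ennreal) (auto simp: mult_2)
    finally show ?thesis using c(1) \<mu>(2) by (simp only: ennreal_plus mult_nonneg_nonneg zero_le_power2)
  qed
  have "(\<lambda>n. \<integral>x. (G n x - F x)\<^sup>2 \<partial>m) \<longlonglongrightarrow> (\<integral>x. 0 \<partial>m)"
  proof (rule integral_dominated_convergence[where w = "\<lambda>x. (F x)\<^sup>2"])
    show "AE x in m. (\<lambda>n. (G n x - F x)\<^sup>2) \<longlonglongrightarrow> 0"
    proof (rule AE_I2)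
      fix x assume "x \<in> space m"
      then have x: "x \<in> X" by (simp add: D.space_eq)
      obtain N :: nat where N: "C + d p x \<le> real N" using real_arch_simple by blast
      have "(G n x - F x)\<^sup>2 = 0" if "n \<ge> N" for n
      proof -
        have "d p x / real (Suc n) \<le> d p x / 1"
          by (rule divide_left_mono) auto
        then have "\<bar>F x\<bar> \<le> h n x"
          using N that bound[OF x] unfolding h_def by simp
        then show ?thesis by (simp add: G_def clamp_id)
      qed
      then show "(\<lambda>n. (G n x - F x)\<^sup>2) \<longlonglongrightarrow> 0"
        by (intro tendsto_eventually eventually_sequentiallyI[of N])
    qed
    show "AE x in m. norm ((G n x - F x)\<^sup>2) \<le> (F x)\<^sup>2" for n
    proof (rule AE_I2)
      fix x
      have "\<bar>G n x - F x\<bar> \<le> \<bar>F x\<bar>"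
        unfolding G_def by (rule abs_clamp_diff_le) (simp add: h_def)
      then show "norm ((G n x - F x)\<^sup>2) \<le> (F x)\<^sup>2" by (simp add: abs_le_square_iff)
    qed
  qed (use L2_measurable[OF F] L2_measurable[OF GL] L2_integrable[OF F] in \<open>auto intro: borel_measurable_power borel_measurable_diff\<close>)
  then have "(\<lambda>n. sqrt (\<integral>x. (G n x - F x)\<^sup>2 \<partial>m)) \<longlonglongrightarrow> sqrt 0"
    by (intro tendsto_real_sqrt) simp
  then have lim: "(\<lambda>n. L2_norm m (\<lambda>x. G n x - F x)) \<longlonglongrightarrow> 0"
    by (simp add: L2_norm_def)
  have "(\<lambda>n. (1 / real (Suc n))\<^sup>2 * \<mu>) \<longlonglongrightarrow> 0\<^sup>2 * \<mu>"
    by (intro tendsto_mult tendsto_power lim_inverse_n'[THEN LIMSEQ_Suc] tendsto_const)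
  then have lim2: "(\<lambda>n. (1 / real (Suc n))\<^sup>2 * \<mu>) \<longlonglongrightarrow> 0" by simp
  show ?thesis
  proof (rule D.cheeger_leI[OF c(1)])
    fix t :: real assume t: "0 < t"
    have "\<forall>\<^sub>F n in sequentially. L2_norm m (\<lambda>x. G n x - F x) < t \<and> (1 / real (Suc n))\<^sup>2 * \<mu> < t"
      by (intro eventually_conj order_tendstoD(2)[OF lim t] order_tendstoD(2)[OF lim2 t])
    then obtain n where n: "L2_norm m (\<lambda>x. G n x - F x) < t" "(1 / real (Suc n))\<^sup>2 * \<mu> < t"
      using eventually_happens' sequentially_bot by blast
    have "ennreal (c + (1 / Suc n)\<^sup>2 * \<mu>) \<le> ennreal (c + t)"
      using n(2) by (intro ennreal_leI) simp
    with n(1) GL Genergy_le[of n]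
    show "\<exists>G\<in>L2 m. L2_norm m (\<lambda>x. G x - F x) < t \<and> D.asymptotic_energy G \<le> ennreal (c + t)"
      by (intro bexI[of _ "G n"] conjI) (auto intro: order_trans)
  qed
qed

lemma cheeger_mono:
  assumes f: "f \<in> L2 m"
  shows "D.cheeger_energy f \<le> E.cheeger_energy f"
proof (cases "E.cheeger_energy f")
  case (real c)
  have "D.cheeger_energy f \<le> ennreal c"
  proof (rule D.cheeger_lsc[OF f real(1)])
    fix t :: real assume t: "0 < t"
    obtain G where "G \<in> L2 m" "L2_norm m (\<lambda>x. G x - f x) < t" "E.asymptotic_energy G \<le> ennreal (c + t)"
      using E.cheeger_approx[OF eq_refl[OF real(2)] real(1) t] by blast
    then show "\<exists>g\<in>L2 m. L2_norm m (\<lambda>x. g x - f x) < t \<and> D.cheeger_energy g \<le> ennreal (c + t)"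
      using cheeger_le_asymptotic_energy real(1) t by (meson add_nonneg_nonneg less_imp_le)
  qed
  then show ?thesis using real by simp
qed simp

end

section \<open>Infima over weighted chains\<close>

text \<open>
  The possible costs of chains ending at a given point. Generating them step by step lets every
  statement about chains be an invariant preserved by one step; the weight is taken at the initial
  point of a step.
\<close>

inductive chain_cost ::
  "'a set \<Rightarrow> ('a \<Rightarrow> 'a \<Rightarrow> real) \<Rightarrow> ('a \<Rightarrow> real) \<Rightarrow> real \<Rightarrow> 'a set \<Rightarrow> ('a \<Rightarrow> real) \<Rightarrow> 'a \<Rightarrow> real \<Rightarrow> bool"
  for X e w \<delta> S f
where
  start: "x \<in> S \<Longrightarrow> chain_cost X e w \<delta> S f x (f x)"
| step: "chain_cost X e w \<delta> S f x t \<Longrightarrow> y \<in> X \<Longrightarrow> e x y \<le> \<delta> \<Longrightarrow> chain_cost X e w \<delta> S f y (t + w x * e x y)"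

text \<open>
  The value \<open>C\<close>, which in the applications bounds \<open>\<bar>f\<bar>\<close>, keeps the infimum meaningful where no chain
  arrives.
\<close>

definition chain_inf ::
  "'a set \<Rightarrow> ('a \<Rightarrow> 'a \<Rightarrow> real) \<Rightarrow> ('a \<Rightarrow> real) \<Rightarrow> real \<Rightarrow> 'a set \<Rightarrow> ('a \<Rightarrow> real) \<Rightarrow> real \<Rightarrow> 'a \<Rightarrow> real"
  where "chain_inf X e w \<delta> S f C x = Inf (insert C {t. chain_cost X e w \<delta> S f x t})"

context Metric_space
begin

lemma chain_cost_ge:
  assumes "chain_cost M d w \<delta> S f x t" "\<And>y. y \<in> S \<Longrightarrow> b \<le> f y" "\<And>y. 0 \<le> w y"
  shows "b \<le> t"
  using assms(1)
proof induction
  case (step x t y)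
  have "0 \<le> w x * d x y" using assms(3) by simp
  then show ?case using step.IH by linarith
qed (use assms(2) in blast)

context
  fixes w f :: "'a \<Rightarrow> real" and \<delta> C :: real and S :: "'a set"
  assumes w: "\<And>y. 0 \<le> w y" and f: "\<And>y. y \<in> S \<Longrightarrow> \<bar>f y\<bar> \<le> C" and C: "0 \<le> C"
begin

lemma chain_bdd_below: "bdd_below (insert C {t. chain_cost M d w \<delta> S f x t})"
proof (rule bdd_belowI[of _ "- C"])
  fix t assume "t \<in> insert C {t. chain_cost M d w \<delta> S f x t}"
  then show "- C \<le> t"
    using chain_cost_ge[of w \<delta> S f x t "- C"] f w C by force
qed

lemma chain_inf_le: "chain_cost M d w \<delta> S f x t \<Longrightarrow> chain_inf M d w \<delta> S f C x \<le> t"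
  unfolding chain_inf_def by (intro cInf_lower chain_bdd_below) auto

lemma chain_inf_ge: "b \<le> C \<Longrightarrow> (\<And>t. chain_cost M d w \<delta> S f x t \<Longrightarrow> b \<le> t) \<Longrightarrow> b \<le> chain_inf M d w \<delta> S f C x"
  unfolding chain_inf_def by (intro cInf_greatest) auto

lemma abs_chain_inf_le: "\<bar>chain_inf M d w \<delta> S f C x\<bar> \<le> C"
proof -
  have "chain_inf M d w \<delta> S f C x \<le> C" unfolding chain_inf_def by (intro cInf_lower chain_bdd_below) auto
  moreover have "- C \<le> chain_inf M d w \<delta> S f C x"
    using chain_cost_ge[of w \<delta> S f x _ "- C"] f w C by (intro chain_inf_ge) force+
  ultimately show ?thesis by linarith
qed

lemma chain_inf_step:
  assumes "x \<in> M" "y \<in> M" "d x y \<le> \<delta>"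
  shows "chain_inf M d w \<delta> S f C y \<le> chain_inf M d w \<delta> S f C x + w x * d x y"
proof -
  have "chain_inf M d w \<delta> S f C y - w x * d x y \<le> chain_inf M d w \<delta> S f C x"
  proof (rule chain_inf_ge)
    show "chain_inf M d w \<delta> S f C y - w x * d x y \<le> C"
      using abs_chain_inf_le[of y] mult_nonneg_nonneg[OF w[of x] nonneg[of x y]] by linarith
    show "chain_inf M d w \<delta> S f C y - w x * d x y \<le> t" if "chain_cost M d w \<delta> S f x t" for t
      using chain_inf_le[OF chain_cost.step[where y = y, OF that]] assms by simp
  qed
  then show ?thesis by linarith
qed

lemma chain_inf_lipschitz:
  assumes "x \<in> M" "y \<in> M" "d x y \<le> \<delta>" "w x \<le> c" "w y \<le> c"
  shows "\<bar>chain_inf M d w \<delta> S f C x - chain_inf M d w \<delta> S f C y\<bar> \<le> c * d x y"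
  using chain_inf_step[OF assms(1,2,3)] chain_inf_step[OF assms(2,1)] assms(3)
    mult_right_mono[OF assms(4) nonneg, of x y] mult_right_mono[OF assms(5) nonneg, of x y]
  by (auto simp: commute)

end
end

text \<open>
  This is where coarse comparability \<open>d \<le> e + \<theta>\<close> on \<open>S\<close> is turned into a bound on \<open>f\<close> along chains of
  arbitrarily small \<open>e\<close>-steps. The anchor \<open>y\<close> is the point of \<open>S\<close> at which the current piece of the
  chain began, and \<open>z\<close> is the last visited point of \<open>S\<close>, still within \<open>r\<close> of \<open>y\<close>. The cost exceeds \<open>f y\<close>
  by what the piece has paid so far, in two ways: with the slope \<open>a y + \<epsilon>\<close> over the
  \<open>e\<close>-distance from \<open>y\<close>, and with the large weight \<open>M\<close> over the \<open>e\<close>-distance from \<open>z\<close>, which measures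
  an excursion outside \<open>S\<close> up to its first step.

  When the chain is back in \<open>S\<close> at distance at least \<open>r\<close> from the anchor, it gets a new anchor, for
  which the cost has to exceed the value of \<open>f\<close>. If the distance is below \<open>2 r\<close>, the
  slope near \<open>y\<close> is at most \<open>a y\<close>, and the reserve \<open>\<epsilon> r\<close> absorbs the loss of \<open>(L + \<epsilon>) \<theta>\<close>. Otherwise the
  chain has jumped by at least \<open>r\<close> from \<open>z\<close> outside \<open>S\<close>, and the weight \<open>M = 4 L\<close> pays for
  everything. The conclusion bounds the cost at points of \<open>S\<close> from below by \<open>f y\<close> with \<open>y\<close> close by.
\<close>

lemma (in comparable_metrics) chain_cost_invariant:
  fixes a w f :: "'a \<Rightarrow> real"
  assumes S: "S \<subseteq> X"
    and f: "\<And>y z. y \<in> X \<Longrightarrow> z \<in> X \<Longrightarrow> \<bar>f y - f z\<bar> \<le> L * d y z"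
    and a: "\<And>y. 0 \<le> a y" "\<And>y. a y \<le> L"
    and fa: "\<And>y z. y \<in> S \<Longrightarrow> z \<in> S \<Longrightarrow> d y z < 2 * r \<Longrightarrow> \<bar>f y - f z\<bar> \<le> a y * d y z"
    and w: "\<And>y. 0 \<le> w y" "\<And>y z. y \<in> S \<Longrightarrow> z \<in> S \<Longrightarrow> d y z < r \<Longrightarrow> a y + \<epsilon> \<le> w z"
      "\<And>y. y \<in> X \<Longrightarrow> y \<notin> S \<Longrightarrow> w y = M"
    and M: "M = 4 * L" "0 < L" "0 < \<epsilon>" "\<epsilon> \<le> L"
    and \<theta>: "\<And>y z. y \<in> S \<Longrightarrow> z \<in> S \<Longrightarrow> d y z \<le> e y z + \<theta>" "0 \<le> \<theta>"
    and small: "(L + \<epsilon>) * \<theta> \<le> \<epsilon> * r" "\<theta> + \<delta> \<le> r / 2" "0 < r" "0 < \<delta>"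
    and chain: "chain_cost X e w \<delta> S f x t"
  shows "x \<in> X \<and> (\<exists>y\<in>S. \<exists>z\<in>S. d y z < r \<and> f y + (a y + \<epsilon>) * e y x \<le> t \<and>
    f y + M * (e z x - \<delta>) \<le> t \<and> (x \<in> S \<longrightarrow> z = x))"
  using chain
proof induction
  case (start x)
  then have "x \<in> X" using S by blast
  moreover have "0 \<le> M * \<delta>" using M small by simp
  ultimately show ?case
    using start small(3) by (intro conjI bexI[of _ x]) (auto simp: right_diff_distrib)
next
  case (step x t x')
  then obtain y z where x: "x \<in> X" and yz: "y \<in> S" "z \<in> S" "d y z < r"
    and t1: "f y + (a y + \<epsilon>) * e y x \<le> t" and t2: "f y + M * (e z x - \<delta>) \<le> t"
    and zx: "x \<in> S \<longrightarrow> z = x" by blast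
  have x': "x' \<in> X" "e x x' \<le> \<delta>" by fact+
  have y: "y \<in> X" and z: "z \<in> X" using yz S by auto
  define t' where "t' = t + w x * e x x'"
  have M0: "0 < M" using M by simp
  \<comment> \<open>Wherever the chain is, the piece keeps paying at least at the rate of its anchor.\<close>
  have wx: "a y + \<epsilon> \<le> w x"
  proof (cases "x \<in> S")
    case False then show ?thesis using w(3)[OF x] M a(2)[of y] by simp
  qed (use w(2) yz zx in auto)
  have t1': "f y + (a y + \<epsilon>) * e y x' \<le> t'"
  proof -
    have "(a y + \<epsilon>) * e y x' \<le> (a y + \<epsilon>) * (e y x + e x x')"
      using E.triangle[OF y x x'(1)] a(1)[of y] M(3) by (intro mult_left_mono) auto
    also have "\<dots> \<le> (a y + \<epsilon>) * e y x + w x * e x x'"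
      using mult_right_mono[OF wx E.nonneg[of x x']] by (simp add: distrib_left)
    finally show ?thesis using t1 unfolding t'_def by linarith
  qed
  have fy: "f y \<le> t'"
  proof -
    have "0 \<le> (a y + \<epsilon>) * e y x'" using a(1)[of y] M(3) by (intro mult_nonneg_nonneg) auto
    then show ?thesis using t1' by linarith
  qed
  have t2': "f y + M * (e z x' - \<delta>) \<le> t'"
  proof (cases "x \<in> S")
    case True
    \<comment> \<open>The first step out of \<open>S\<close> is paid at a low rate, but its length is at most \<open>\<delta>\<close>.\<close>
    then have "M * (e z x' - \<delta>) \<le> 0"
      using zx x'(2) M0 by (simp add: mult_le_0_iff)
    then show ?thesis using fy by linarith
  next
    case False
    have "M * (e z x' - \<delta>) \<le> M * (e z x + e x x' - \<delta>)"
      using E.triangle[OF z x x'(1)] M0 by (intro mult_left_mono) auto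
    also have "\<dots> = M * (e z x - \<delta>) + w x * e x x'"
      using w(3)[OF x False] by (simp add: algebra_simps)
    finally show ?thesis using t2 unfolding t'_def by linarith
  qed
  have M\<delta>: "0 \<le> M * \<delta>" using M0 small by simp
  have new: ?case if "x' \<in> S" "f x' \<le> t'"
    using that x'(1) small(3) M\<delta> unfolding t'_def
    by (intro conjI bexI[of _ x']) (auto simp: right_diff_distrib)
  show ?case
  proof (cases "x' \<in> S")
    case False
    then show ?thesis using yz t1' t2' x'(1) unfolding t'_def by blast
  next
    case True
    show ?thesis
    proof (cases "d y x' < r")
      case True
      have "f y + M * (e x' x' - \<delta>) \<le> t'" using fy M\<delta> x'(1) by (simp add: right_diff_distrib)
      then show ?thesis using True \<open>x' \<in> S\<close> yz(1) t1' x'(1) unfolding t'_def by blast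
    next
      case far: False
      show ?thesis
      proof (cases "d y x' < 2 * r")
        case True
        have "f x' \<le> f y + a y * d y x'"
          using fa[OF yz(1) \<open>x' \<in> S\<close> True] by linarith
        moreover have "(a y + \<epsilon>) * d y x' \<le> (a y + \<epsilon>) * (e y x' + \<theta>)"
          using \<theta>(1)[OF yz(1) \<open>x' \<in> S\<close>] a(1)[of y] M(3) by (intro mult_left_mono) auto
        moreover have "(a y + \<epsilon>) * \<theta> \<le> (L + \<epsilon>) * \<theta>"
          using a(2)[of y] \<theta>(2) by (intro mult_right_mono) auto
        moreover have "\<epsilon> * r \<le> \<epsilon> * d y x'"
          using far M(3) by (intro mult_left_mono) auto
        ultimately have "f x' \<le> t'"
          using t1' small(1) by (simp add: algebra_simps)
        then show ?thesis using new \<open>x' \<in> S\<close> by blast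
      next
        case False
        \<comment> \<open>The step from the ball around \<open>y\<close> to \<open>x'\<close> is an excursion that covers at least \<open>r\<close>.\<close>
        let ?D = "d z x'"
        have D: "r \<le> ?D" "d y x' \<le> r + ?D"
          using D.triangle[OF y z x'(1)] yz(3) False by auto
        have "f x' \<le> f y + L * d y x'" using f[OF y x'(1)] by linarith
        also have "L * d y x' \<le> L * (2 * ?D)"
          using D M(2) by (intro mult_left_mono) auto
        also have "\<dots> = M * (?D / 2)" using M(1) by simp
        also have "\<dots> \<le> M * (e z x' - \<delta>)"
          using \<theta>(1)[OF yz(2) \<open>x' \<in> S\<close>] D(1) small(2) M0 by (intro mult_left_mono) auto
        finally have "f x' \<le> t'" using t2' by linarith
        then show ?thesis using new \<open>x' \<in> S\<close> by blast
      qed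
    qed
  qed
qed

section \<open>Regularization by chains\<close>

text \<open>
  Soft thresholding, which annihilates values up to \<open>\<eta>\<close> and keeps Lipschitz constants.
\<close>

definition soft :: "real \<Rightarrow> real \<Rightarrow> real"
  where "soft \<eta> a = a - clamp \<eta> a"

lemma soft_lipschitz: "0 \<le> \<eta> \<Longrightarrow> \<bar>soft \<eta> a - soft \<eta> b\<bar> \<le> \<bar>a - b\<bar>"
  by (auto simp: soft_def clamp_def max_def min_def)

lemma soft_zero: "\<bar>a\<bar> \<le> \<eta> \<Longrightarrow> soft \<eta> a = 0"
  by (auto simp: soft_def clamp_def)

lemma abs_soft_diff_le: "0 \<le> \<eta> \<Longrightarrow> \<bar>soft \<eta> a - a\<bar> \<le> \<eta>"
  by (auto simp: soft_def clamp_def)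

lemma abs_soft_le: "0 \<le> \<eta> \<Longrightarrow> \<bar>soft \<eta> a\<bar> \<le> \<bar>a\<bar>"
  by (auto simp: soft_def clamp_def)

text \<open>
  The approximation is \<open>F = clamp h (soft \<eta> u)\<close>, where \<open>u\<close> is the infimum over chains. On \<open>S\<close> it satisfies
  \<open>f - \<eta> \<le> u \<le> f\<close>. Without further measures \<open>u\<close> could be of size \<open>\<eta>\<close> far away, where the truncation
  by \<open>h\<close> would cost energy on all of \<open>B\<close>. The threshold removes this: on \<open>S\<close>, outside the support of
  \<open>f\<close>, the function vanishes before it is truncated, and near the support \<open>h\<close> exceeds \<open>C\<close> and the
  truncation has no effect. The slope of \<open>h\<close> is therefore visible only off \<open>S\<close>, where \<open>M\<close> bounds
  all slopes anyway.
\<close>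

lemma (in comparable_metrics) chain_approximation:
  assumes top: "E.mtopology = D.mtopology" and p: "p \<in> X" and pos: "0 < L" "0 < R" "0 < C"
    and flip: "\<And>x y. x \<in> X \<Longrightarrow> y \<in> X \<Longrightarrow> \<bar>f x - f y\<bar> \<le> L * d x y"
    and fsupp: "\<And>x. x \<in> X \<Longrightarrow> R < d p x \<Longrightarrow> f x = 0"
    and fbound: "\<And>x. x \<in> X \<Longrightarrow> \<bar>f x\<bar> \<le> C"
    and S: "openin D.mtopology S"
    and \<epsilon>: "0 < \<epsilon>" "\<epsilon> \<le> L" and s: "0 < s"
    and \<theta>: "\<And>y z. y \<in> S \<Longrightarrow> z \<in> S \<Longrightarrow> d y z \<le> e y z + \<theta>" "0 \<le> \<theta>" "(L + \<epsilon>) * \<theta> \<le> \<epsilon> * (s / 4)" "\<theta> < s / 8"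
    and B: "B \<in> sets m" "E.mcball p (R + 1 + C / (4 * L)) \<subseteq> B"
  shows "\<exists>F. F \<in> L2 m \<and>
    E.asymptotic_energy F \<le> ((\<integral>\<^sup>+x. (D.Lip f (D.mball x (2 * s)) + ennreal \<epsilon>)\<^sup>2 * indicator B x \<partial>m)
      + ennreal ((4 * L)\<^sup>2) * emeasure m (B - S)) / 2 \<and>
    (\<integral>\<^sup>+x. ennreal ((F x - f x)\<^sup>2) \<partial>m)
      \<le> ennreal ((L * s / 2)\<^sup>2) * emeasure m B + ennreal ((2 * C)\<^sup>2) * emeasure m (B - S)"
proof -
  have SX: "S \<subseteq> X" using openin_subset[OF S] by simp
  have SE: "openin E.mtopology S" using S top by simp
  have Dball_E: "openin E.mtopology (D.mball x t)" for x t using top by simp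
  define \<delta> where "\<delta> = s / 8 - \<theta>"
  have \<delta>: "0 < \<delta>" using \<theta>(4) by (simp add: \<delta>_def)
  define M where "M = 4 * L"
  have M: "0 < M" "L + \<epsilon> \<le> M" using pos \<epsilon> by (auto simp: M_def)
  define l where "l t x = enn2real (D.Lip f (D.mball x t))" for t x
  have Lip_L: "D.Lip f (D.mball x t) \<le> ennreal L" for x t
    by (rule D.Lip_le[OF flip]) auto
  have l: "D.Lip f (D.mball x t) = ennreal (l t x)" for x t
    using le_less_trans[OF Lip_L ennreal_less_top] by (simp add: l_def)
  have l0: "0 \<le> l t x" for t x by (simp add: l_def)
  have lL: "l t x \<le> L" for t x
    using Lip_L[of x t] pos by (simp add: l)
  have l_mono: "l t x \<le> l t' y" if "D.mball x t \<subseteq> D.mball y t'" for t t' x y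
    using D.Lip_mono[OF that, of f] by (simp add: l l0)
  have l_bound: "\<bar>f y - f z\<bar> \<le> l t x * d y z" if "y \<in> D.mball x t" "z \<in> D.mball x t" for x y z t
    by (rule D.Lip_bound[OF _ that]) (auto simp: l l0)
  \<comment> \<open>The scale \<open>s\<close> leaves room: the slope at \<open>y\<close> on scale \<open>s / 2\<close> is dominated by \<open>w\<close> at all points of
     \<open>S\<close> within \<open>s / 4\<close> of \<open>y\<close>, and \<open>w\<close> near \<open>x\<close> by the slope at \<open>x\<close> on scale \<open>2 s\<close>.\<close>
  define w where "w x = (if x \<in> S then l s x + \<epsilon> else M)" for x
  have w: "0 \<le> w x" "w x \<le> M" for x
    using M \<epsilon> l0[of s x] lL[of s x] by (auto simp: w_def)
  define u where "u = chain_inf X e w \<delta> S f C"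
  have u_abs: "\<bar>u x\<bar> \<le> C" for x
    unfolding u_def by (rule E.abs_chain_inf_le) (use w fbound SX pos in auto)
  have u_lip: "\<bar>u x - u y\<bar> \<le> c * e x y" if "x \<in> X" "y \<in> X" "e x y \<le> \<delta>" "w x \<le> c" "w y \<le> c" for x y c
    unfolding u_def by (rule E.chain_inf_lipschitz[OF _ _ _ that]) (use w fbound SX pos in auto)
  define \<eta> where "\<eta> = L * (s / 4)"
  have \<eta>: "0 < \<eta>" using pos s by (simp add: \<eta>_def)
  have u_le: "u x \<le> f x" if "x \<in> S" for x
    unfolding u_def by (rule E.chain_inf_le[OF _ _ _ chain_cost.start[OF that]]) (use w fbound SX pos in auto)
  have u_ge: "f x - \<eta> \<le> u x" if x: "x \<in> S" for x
    unfolding u_def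
  proof (rule E.chain_inf_ge)
    have "f x \<le> C" using fbound[of x] x SX by auto
    then show "f x - \<eta> \<le> C" using \<eta> by simp
    fix t assume t: "chain_cost X e w \<delta> S f x t"
    have "x \<in> X \<and> (\<exists>y\<in>S. \<exists>z\<in>S. d y z < s / 4 \<and> f y + (l (s / 2) y + \<epsilon>) * e y x \<le> t \<and>
        f y + M * (e z x - \<delta>) \<le> t \<and> (x \<in> S \<longrightarrow> z = x))"
    proof (rule chain_cost_invariant[where L = L and \<theta> = \<theta> and w = w, OF SX flip l0 lL _ w(1) _ _ M_def pos(1) \<epsilon> \<theta>(1,2,3) _ _ \<delta> t])
      show "\<bar>f y - f z\<bar> \<le> l (s / 2) y * d y z" if "y \<in> S" "z \<in> S" "d y z < 2 * (s / 4)" for y z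
        by (rule l_bound) (use that SX s in auto)
      show "l (s / 2) y + \<epsilon> \<le> w z" if "y \<in> S" "z \<in> S" "d y z < s / 4" for y z
      proof -
        have "D.mball y (s / 2) \<subseteq> D.mball z s"
          using that SX s by (intro D.mball_subset) auto
        from l_mono[OF this] show ?thesis using that by (simp add: w_def)
      qed
      show "w y = M" if "y \<notin> S" for y using that by (simp add: w_def)
      show "\<theta> + \<delta> \<le> s / 4 / 2" by (simp add: \<delta>_def)
    qed (use s in auto)
    then obtain y where y: "y \<in> S" "d y x < s / 4" "f y + (l (s / 2) y + \<epsilon>) * e y x \<le> t"
      using x by blast
    have "0 \<le> (l (s / 2) y + \<epsilon>) * e y x"
      using l0[of "s / 2" y] \<epsilon> by (intro mult_nonneg_nonneg) auto
    moreover have "f x - f y \<le> L * d y x"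
      using flip[of y x] y(1) x SX by fastforce
    moreover have "L * d y x \<le> \<eta>"
      using y(2) pos unfolding \<eta>_def by (intro mult_left_mono) auto
    ultimately show "f x - \<eta> \<le> t" using y(3) by linarith
  qed (use w fbound SX pos in auto)
  define h where "h x = M * max 0 (R + 1 + C / M - e p x)" for x
  have h0: "0 \<le> h x" for x using M by (simp add: h_def)
  have h_lip: "\<bar>h x - h y\<bar> \<le> M * e x y" if "x \<in> X" "y \<in> X" for x y
  proof -
    have "\<bar>e p x - e p y\<bar> \<le> e x y"
      using E.mdist_reverse_triangle[OF that(1) p that(2)] by (simp add: E.commute)
    then have "\<bar>max 0 (R + 1 + C / M - e p x) - max 0 (R + 1 + C / M - e p y)\<bar> \<le> e x y"
      by (auto simp: max_def)
    then show ?thesis unfolding h_def right_diff_distrib[symmetric] abs_mult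
      using M by (simp add: mult_left_mono)
  qed
  have h_ge: "C \<le> h x" if "x \<in> X" "d p x < R + 1" for x
  proof -
    have "M * (C / M) \<le> M * max 0 (R + 1 + C / M - e p x)"
      using le[OF p that(1)] that(2) M by (intro mult_left_mono) auto
    then show ?thesis using M by (simp add: h_def)
  qed
  define F where "F x = clamp (h x) (soft \<eta> (u x))" for x
  have F_near: "F x = soft \<eta> (u x)" if "x \<in> X" "d p x < R + 1" for x
    unfolding F_def
    by (rule clamp_id) (use h_ge[OF that] u_abs[of x] abs_soft_le[of \<eta> "u x"] \<eta> in linarith)
  have F_far: "F x = 0" if "x \<in> S" "R < d p x" for x
  proof -
    have "f x = 0" using fsupp that SX by blast
    then have "\<bar>u x\<bar> \<le> \<eta>" using u_le[OF that(1)] u_ge[OF that(1)] \<eta> by linarith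
    then show ?thesis by (simp add: F_def soft_zero clamp_zero h0)
  qed
  have F_supp: "F x = 0" if "R + 1 + C / M \<le> e p x" for x
    using that by (simp add: F_def h_def clamp_zero)
  have F_abs: "\<bar>F x\<bar> \<le> C" for x
    using abs_clamp_le[OF h0, of x "soft \<eta> (u x)"] abs_soft_le[of \<eta> "u x"] u_abs[of x] \<eta>
    unfolding F_def by linarith
  have F_lip_local: "\<bar>F x - F y\<bar> \<le> M * e x y" if "x \<in> X" "y \<in> X" "e x y \<le> \<delta>" for x y
    using clamp_lipschitz[of "h x" "soft \<eta> (u x)" "h y" "soft \<eta> (u y)"]
      soft_lipschitz[of \<eta> "u x" "u y"] \<eta> u_lip[OF that w(2) w(2)] h_lip[OF that(1,2)]
    unfolding F_def by linarith
  \<comment> \<open>Beyond distance \<open>\<delta>\<close> boundedness takes over from the local estimate.\<close>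
  define K where "K = M + 2 * C / \<delta>"
  have K: "0 < K" using M pos \<delta> by (simp add: K_def add_pos_pos)
  have F_lip: "\<bar>F x - F y\<bar> \<le> K * e x y" if "x \<in> X" "y \<in> X" for x y
  proof (cases "e x y \<le> \<delta>")
    case True
    have "0 \<le> 2 * C / \<delta> * e x y" using pos \<delta> by simp
    then show ?thesis using F_lip_local[OF that True] by (simp add: K_def distrib_right)
  next
    case False
    have "2 * C = 2 * C / \<delta> * \<delta>" using \<delta> by simp
    also have "\<dots> \<le> 2 * C / \<delta> * e x y" using False pos \<delta> by (intro mult_left_mono) auto
    finally have "2 * C \<le> K * e x y" using M by (simp add: K_def distrib_right add_increasing)
    then show ?thesis using F_abs[of x] F_abs[of y] by linarith
  qed
  have R2: "0 < R + 1 + C / M" using pos M by (simp add: add_pos_pos)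
  have supp': "F x = 0" if "x \<in> X" "R + 1 + C / M < e p x" for x
    using F_supp that by simp
  have F_L2: "F \<in> L2 m"
    by (rule E.L2_bounded_support[where R = "R + 1 + C / M", OF E.Lipschitz_measurable[OF F_lip K] F_abs supp' p])
  have energy: "E.asymptotic_energy F = (\<integral>\<^sup>+x. (E.asymptotic_slope F x)\<^sup>2 \<partial>m) / 2"
    by (rule E.asymptotic_energy_eq[OF F_lip K supp' R2 p])
  have slope: "(E.asymptotic_slope F x)\<^sup>2 \<le>
      (D.Lip f (D.mball x (2 * s)) + ennreal \<epsilon>)\<^sup>2 * indicator B x + ennreal (M\<^sup>2) * indicator (B - S) x"
    if x: "x \<in> X" for x
  proof -
    consider (out) "x \<notin> B" | (S) "x \<in> B" "x \<in> S" | (bad) "x \<in> B" "x \<notin> S" by blast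
    then show ?thesis
    proof cases
      case out
      then have "x \<notin> E.mcball p (R + 1 + C / M)" using B(2) by (auto simp: M_def)
      then have far: "R + 1 + C / M < e p x" using x p by simp
      have "E.asymptotic_slope F x \<le> ennreal 0"
      proof (rule E.slope_le)
        show "0 < e p x - (R + 1 + C / M)" using far by simp
        have "F y = 0" if "y \<in> E.mball x (e p x - (R + 1 + C / M))" for y
          using that E.triangle[OF p _ x, of y] by (intro F_supp) (auto simp: E.commute)
        then show "\<bar>F y - F z\<bar> \<le> 0 * e y z"
          if "y \<in> E.mball x (e p x - (R + 1 + C / M))" "z \<in> E.mball x (e p x - (R + 1 + C / M))" for y z
          using that by simp
      qed
      then show ?thesis by simp
    next
      case bad
      have "E.asymptotic_slope F x \<le> ennreal M"
      proof (rule E.slope_le)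
        show "0 < \<delta> / 2" using \<delta> by simp
        show "\<bar>F y - F z\<bar> \<le> M * e y z" if "y \<in> E.mball x (\<delta> / 2)" "z \<in> E.mball x (\<delta> / 2)" for y z
          using that E.triangle[of y x z] by (intro F_lip_local) (auto simp: E.commute)
      qed
      then have "(E.asymptotic_slope F x)\<^sup>2 \<le> (ennreal M)\<^sup>2" by (rule power_mono) simp
      then show ?thesis using bad M by (simp add: ennreal_power add_increasing)
    next
      case S
      have "E.asymptotic_slope F x \<le> ennreal (l (2 * s) x + \<epsilon>)"
      proof (cases "d p x < R + 1")
        case True
        have "openin E.mtopology (S \<inter> D.mball x s \<inter> D.mball p (R + 1))"
          by (intro openin_Int SE Dball_E)
        moreover have "x \<in> S \<inter> D.mball x s \<inter> D.mball p (R + 1)"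
          using S x p s True by auto
        ultimately obtain t where t: "0 < t" "E.mball x t \<subseteq> S \<inter> D.mball x s \<inter> D.mball p (R + 1)"
          unfolding E.openin_mtopology by blast
        show ?thesis
        proof (rule E.slope_le)
          show "0 < min t (\<delta> / 2)" using t \<delta> by simp
          fix y z assume "y \<in> E.mball x (min t (\<delta> / 2))" "z \<in> E.mball x (min t (\<delta> / 2))"
          then have yz: "y \<in> E.mball x t" "z \<in> E.mball x t" "y \<in> X" "z \<in> X" "e x y < \<delta> / 2" "e x z < \<delta> / 2"
            by auto
          have e: "e y z \<le> \<delta>" using E.triangle[OF yz(3) x yz(4)] yz by (simp add: E.commute)
          have wl: "w v \<le> l (2 * s) x + \<epsilon>" if "v \<in> E.mball x t" for v
          proof -
            have v: "v \<in> S" "d x v < s" "v \<in> X" using that t(2) by auto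
            have "D.mball v s \<subseteq> D.mball x (2 * s)"
              using v x by (intro D.mball_subset) (auto simp: D.commute)
            from l_mono[OF this] show ?thesis using v by (simp add: w_def)
          qed
          have "F y = soft \<eta> (u y)" "F z = soft \<eta> (u z)"
            using yz t(2) by (auto intro!: F_near)
          then have "\<bar>F y - F z\<bar> \<le> \<bar>u y - u z\<bar>" using soft_lipschitz[of \<eta> "u y" "u z"] \<eta> by simp
          also have "\<dots> \<le> (l (2 * s) x + \<epsilon>) * e y z"
            by (rule u_lip[OF yz(3,4) e wl[OF yz(1)] wl[OF yz(2)]])
          finally show "\<bar>F y - F z\<bar> \<le> (l (2 * s) x + \<epsilon>) * e y z" .
        qed
      next
        case False
        have "openin E.mtopology (S \<inter> D.mball x 1)"
          by (intro openin_Int SE Dball_E)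
        moreover have "x \<in> S \<inter> D.mball x 1" using S x by auto
        ultimately obtain t where t: "0 < t" "E.mball x t \<subseteq> S \<inter> D.mball x 1"
          unfolding E.openin_mtopology by blast
        show ?thesis
        proof (rule E.slope_le[OF t(1)])
          have zero: "F v = 0" if "v \<in> E.mball x t" for v
          proof (rule F_far)
            have v: "v \<in> S" "d x v < 1" "v \<in> X" using that t(2) by auto
            show "v \<in> S" by fact
            show "R < d p v" using D.triangle[OF p v(3) x] v(2) False by (simp add: D.commute)
          qed
          show "\<bar>F y - F z\<bar> \<le> (l (2 * s) x + \<epsilon>) * e y z" if "y \<in> E.mball x t" "z \<in> E.mball x t" for y z
            using zero[OF that(1)] zero[OF that(2)] l0[of "2 * s" x] \<epsilon> by simp
        qed
      qed
      then have "(E.asymptotic_slope F x)\<^sup>2 \<le> (ennreal (l (2 * s) x + \<epsilon>))\<^sup>2" by (rule power_mono) simp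
      then show ?thesis using S \<epsilon> by (simp add: l l0)
    qed
  qed
  have diff: "ennreal ((F x - f x)\<^sup>2) \<le> ennreal ((L * s / 2)\<^sup>2) * indicator B x + ennreal ((2 * C)\<^sup>2) * indicator (B - S) x"
    if x: "x \<in> X" for x
  proof -
    consider (out) "x \<notin> B" | (S) "x \<in> B" "x \<in> S" | (bad) "x \<in> B" "x \<notin> S" by blast
    then show ?thesis
    proof cases
      case out
      then have "x \<notin> E.mcball p (R + 1 + C / M)" using B(2) by (auto simp: M_def)
      then have far: "R + 1 + C / M < e p x" using x p by simp
      moreover have "0 \<le> C / M" using pos M by simp
      ultimately have "R < d p x" using le[OF p x] by linarith
      then show ?thesis using F_supp far fsupp[OF x] by simp
    next
      case bad
      have "\<bar>F x - f x\<bar> \<le> \<bar>2 * C\<bar>" using F_abs[of x] fbound[OF x] by linarith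
      then have "(F x - f x)\<^sup>2 \<le> (2 * C)\<^sup>2" by (simp only: abs_le_square_iff)
      then show ?thesis using bad by (simp add: add_increasing)
    next
      case S
      have "\<bar>F x - f x\<bar> \<le> 2 * \<eta>"
      proof (cases "d p x < R + 1")
        case True
        show ?thesis
          using F_near[OF x True] abs_soft_diff_le[of \<eta> "u x"] u_le[OF S(2)] u_ge[OF S(2)] \<eta> by linarith
      next
        case False
        then show ?thesis using F_far[OF S(2)] fsupp[OF x] \<eta> by simp
      qed
      then have "\<bar>F x - f x\<bar> \<le> \<bar>L * s / 2\<bar>" by (simp add: \<eta>_def)
      then have "(F x - f x)\<^sup>2 \<le> (L * s / 2)\<^sup>2" by (simp only: abs_le_square_iff)
      then show ?thesis using S by (simp add: ennreal_leI)
    qed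
  qed
  have Smeas: "B - S \<in> sets m" using B(1) D.openin_sets[OF S] by simp
  have [measurable]: "(\<lambda>x. D.Lip f (D.mball x (2 * s))) \<in> borel_measurable m"
    by (rule D.Lip_ball_measurable)
  have "(\<integral>\<^sup>+x. (E.asymptotic_slope F x)\<^sup>2 \<partial>m) \<le> (\<integral>\<^sup>+x. (D.Lip f (D.mball x (2 * s)) + ennreal \<epsilon>)\<^sup>2 * indicator B x
      + ennreal (M\<^sup>2) * indicator (B - S) x \<partial>m)"
    by (rule nn_integral_mono) (use slope in \<open>simp only: D.space_eq\<close>)
  also have "\<dots> = (\<integral>\<^sup>+x. (D.Lip f (D.mball x (2 * s)) + ennreal \<epsilon>)\<^sup>2 * indicator B x \<partial>m)
      + ennreal (M\<^sup>2) * emeasure m (B - S)"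
    using B(1) Smeas by (subst nn_integral_add) (auto simp: nn_integral_cmult_indicator)
  finally have en: "E.asymptotic_energy F \<le> ((\<integral>\<^sup>+x. (D.Lip f (D.mball x (2 * s)) + ennreal \<epsilon>)\<^sup>2 * indicator B x \<partial>m)
      + ennreal (M\<^sup>2) * emeasure m (B - S)) / 2"
    unfolding energy by (rule divide_right_mono_ennreal)
  have "(\<integral>\<^sup>+x. ennreal ((F x - f x)\<^sup>2) \<partial>m) \<le> (\<integral>\<^sup>+x. ennreal ((L * s / 2)\<^sup>2) * indicator B x
      + ennreal ((2 * C)\<^sup>2) * indicator (B - S) x \<partial>m)"
    by (rule nn_integral_mono) (use diff in \<open>simp only: D.space_eq\<close>)
  also have "\<dots> = ennreal ((L * s / 2)\<^sup>2) * emeasure m B + ennreal ((2 * C)\<^sup>2) * emeasure m (B - S)"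
    using B(1) Smeas by (subst nn_integral_add) (auto simp: nn_integral_cmult_indicator)
  finally show ?thesis using F_L2 en unfolding M_def by blast
qed

section \<open>Passage to the limit\<close>

text \<open>
  Up to small measure, a set of finite measure is covered by finitely many balls of a given radius.
  At a single fixed scale this takes the place of a compact set.
\<close>

lemma (in metric_measure_space) finite_ball_cover:
  assumes B: "B \<in> sets m" "emeasure m B < \<infinity>" and \<rho>: "0 < \<rho>" and e: "0 < e"
  obtains Q where "finite Q" "Q \<subseteq> X" "emeasure m (B - (\<Union>q\<in>Q. mball q \<rho>)) < ennreal e"
proof (cases "X = {}")
  case True
  then have "B = {}" using sets.sets_into_space[OF B(1)] by (simp add: space_eq)
  then show thesis using e by (intro that[of "{}"]) auto
next
  case False
  obtain D where D: "countable D" "D \<subseteq> X" "mtopology closure_of D = X"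
    using separable unfolding separable_space_def by auto
  have cover: "\<exists>q\<in>D. x \<in> mball q \<rho>" if x: "x \<in> X" for x
  proof -
    have "x \<in> mtopology closure_of D" using x D(3) by simp
    then obtain q where "q \<in> D" "q \<in> mball x \<rho>"
      unfolding metric_closure_of using \<rho> by blast
    then show ?thesis by (auto simp: commute)
  qed
  then have "D \<noteq> {}" using False by blast
  define q where "q = from_nat_into D"
  have q: "range q = D" unfolding q_def by (rule range_from_nat_into[OF \<open>D \<noteq> {}\<close> D(1)])
  define A where "A n = B - (\<Union>k<n. mball (q k) \<rho>)" for n
  have open_un: "openin mtopology (\<Union>k<n. mball (q k) \<rho>)" for n by (intro openin_Union) auto
  have A: "A n \<in> sets m" for n
    unfolding A_def using B(1) openin_sets[OF open_un] by (rule sets.Diff)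
  have dec: "decseq A" unfolding A_def by (rule decseq_SucI) (auto simp: lessThan_Suc)
  have inter: "(\<Inter>n. A n) = {}"
  proof (rule equals0I)
    fix x assume x: "x \<in> (\<Inter>n. A n)"
    then have "x \<in> X" using sets.sets_into_space[OF A[of 0]] by (auto simp: space_eq)
    then obtain k where k: "x \<in> mball (q k) \<rho>" using cover q by blast
    have "x \<in> A (Suc k)" using x by blast
    then show False using k unfolding A_def by blast
  qed
  have A_fin: "emeasure m (A n) \<noteq> \<infinity>" for n
    using emeasure_mono[of "A n" B m] B by (auto simp: A_def top_unique)
  have "(\<lambda>n. emeasure m (A n)) \<longlonglongrightarrow> emeasure m (\<Inter>n. A n)"
    using A by (intro Lim_emeasure_decseq dec A_fin) auto
  then have "(\<lambda>n. emeasure m (A n)) \<longlonglongrightarrow> 0" unfolding inter by simp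
  from order_tendstoD(2)[OF this, of "ennreal e"] e
  obtain n where "emeasure m (A n) < ennreal e"
    by (auto simp: eventually_sequentially)
  moreover have "A n = B - (\<Union>p\<in>q ` {..<n}. mball p \<rho>)" by (auto simp: A_def)
  ultimately show thesis using q D(2) by (intro that[of "q ` {..<n}"]) auto
qed

text \<open>
  Lower semicontinuity of the sum of the energies of two functions, along approximations of both
  for which only the sum is controlled. The separate statements give finiteness; then each summand is
  at least \<open>a - t\<close>, respectively \<open>b - t\<close>, on a neighbourhood.
\<close>

lemma (in metric_measure_space) cheeger_lsc_pair:
  assumes f: "f \<in> L2 m" and g: "g \<in> L2 m" and c: "0 \<le> c"
    and approx: "\<And>e. 0 < e \<Longrightarrow> \<exists>f'\<in>L2 m. \<exists>g'\<in>L2 m. L2_norm m (\<lambda>x. f' x - f x) < e \<and>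
      L2_norm m (\<lambda>x. g' x - g x) < e \<and> cheeger_energy f' + cheeger_energy g' \<le> ennreal (c + e)"
  shows "cheeger_energy f + cheeger_energy g \<le> ennreal c"
proof -
  have "cheeger_energy f \<le> ennreal c"
  proof (rule cheeger_lsc[OF f c])
    fix e :: real assume "0 < e"
    then obtain f' g' where *: "f' \<in> L2 m" "L2_norm m (\<lambda>x. f' x - f x) < e" "cheeger_energy f' + cheeger_energy g' \<le> ennreal (c + e)"
      using approx by blast
    have "cheeger_energy f' \<le> ennreal (c + e)" by (rule order_trans[OF _ *(3)]) simp
    with * show "\<exists>h\<in>L2 m. L2_norm m (\<lambda>x. h x - f x) < e \<and> cheeger_energy h \<le> ennreal (c + e)" by blast
  qed
  then obtain a where a: "cheeger_energy f = ennreal a" "0 \<le> a"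
    by (cases "cheeger_energy f") (auto simp: top_unique)
  have "cheeger_energy g \<le> ennreal c"
  proof (rule cheeger_lsc[OF g c])
    fix e :: real assume "0 < e"
    then obtain f' g' where *: "g' \<in> L2 m" "L2_norm m (\<lambda>x. g' x - g x) < e" "cheeger_energy f' + cheeger_energy g' \<le> ennreal (c + e)"
      using approx by blast
    have "cheeger_energy g' \<le> ennreal (c + e)" by (rule order_trans[OF _ *(3)]) simp
    with * show "\<exists>h\<in>L2 m. L2_norm m (\<lambda>x. h x - g x) < e \<and> cheeger_energy h \<le> ennreal (c + e)" by blast
  qed
  then obtain b where b: "cheeger_energy g = ennreal b" "0 \<le> b"
    by (cases "cheeger_energy g") (auto simp: top_unique)
  have near: "\<exists>e>0. \<forall>k\<in>L2 m. L2_norm m (\<lambda>x. k x - h x) < e \<longrightarrow> ennreal (z - t) \<le> cheeger_energy k"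
    if h: "h \<in> L2 m" and z: "cheeger_energy h = ennreal z" and t: "0 < t" for h z t
  proof (cases "z - t \<le> 0")
    case True
    then show ?thesis by (intro exI[of _ 1]) (simp add: ennreal_neg)
  next
    case False
    show ?thesis
    proof (rule ccontr)
      assume none: "\<not> ?thesis"
      have neg: "\<exists>k\<in>L2 m. L2_norm m (\<lambda>x. k x - h x) < e \<and> cheeger_energy k \<le> ennreal (z - t)" if "0 < e" for e
      proof (rule ccontr)
        assume "\<not> ?thesis"
        then have "\<forall>k\<in>L2 m. L2_norm m (\<lambda>x. k x - h x) < e \<longrightarrow> ennreal (z - t) \<le> cheeger_energy k"
          using linear by blast
        with none that show False by blast
      qed
      have "cheeger_energy h \<le> ennreal (z - t)"
      proof (rule cheeger_lsc[OF h])
        fix e :: real assume e: "0 < e"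
        have "ennreal (z - t) \<le> ennreal (z - t + e)" using e by (intro ennreal_leI) simp
        with neg[OF e] show "\<exists>k\<in>L2 m. L2_norm m (\<lambda>x. k x - h x) < e \<and> cheeger_energy k \<le> ennreal (z - t + e)"
          using order_trans by blast
      qed (use False in simp)
      then show False using False t unfolding z by simp
    qed
  qed
  have close: "a + b \<le> c + 3 * t" if t: "0 < t" for t
  proof -
    obtain e1 where e1: "0 < e1" "\<And>k. k \<in> L2 m \<Longrightarrow> L2_norm m (\<lambda>x. k x - f x) < e1 \<Longrightarrow> ennreal (a - t) \<le> cheeger_energy k"
      using near[OF f a(1) t] by blast
    obtain e2 where e2: "0 < e2" "\<And>k. k \<in> L2 m \<Longrightarrow> L2_norm m (\<lambda>x. k x - g x) < e2 \<Longrightarrow> ennreal (b - t) \<le> cheeger_energy k"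
      using near[OF g b(1) t] by blast
    define e where "e = min t (min e1 e2)"
    have e: "0 < e" "e \<le> t" "e \<le> e1" "e \<le> e2" using t e1(1) e2(1) by (auto simp: e_def)
    obtain f' g' where "f' \<in> L2 m" "g' \<in> L2 m" "L2_norm m (\<lambda>x. f' x - f x) < e"
      "L2_norm m (\<lambda>x. g' x - g x) < e" and sum: "cheeger_energy f' + cheeger_energy g' \<le> ennreal (c + e)"
      using approx[OF e(1)] by blast
    then have "ennreal (a - t) \<le> cheeger_energy f'" "ennreal (b - t) \<le> cheeger_energy g'"
      using e by (auto intro: e1(2) e2(2))
    then have "ennreal (a - t) + ennreal (b - t) \<le> ennreal (c + e)"
      by (rule order_trans[OF add_mono sum])
    moreover have "ennreal (a - t + (b - t)) \<le> ennreal (a - t) + ennreal (b - t)"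
      by (cases "0 \<le> a - t"; cases "0 \<le> b - t") (auto simp: ennreal_neg not_le intro: ennreal_leI simp flip: ennreal_plus)
    ultimately have "ennreal (a - t + (b - t)) \<le> ennreal (c + e)" by (rule order_trans[rotated])
    moreover have "0 \<le> c + e" using c e(1) by simp
    ultimately have "a - t + (b - t) \<le> c + e" by (simp only: ennreal_le_iff)
    then show ?thesis using e(2) by linarith
  qed
  have "a + b \<le> c"
    by (rule field_le_epsilon) (use close[of "_ / 3"] in simp)
  then show ?thesis using a b by (simp add: ennreal_leI flip: ennreal_plus)
qed

context infinitesimally_hilbertian
begin

lemma cheeger_cmult:
  assumes "f \<in> W12"
  shows "cheeger_energy (\<lambda>x. c * f x) = ennreal (c\<^sup>2) * cheeger_energy f"
proof -
  have cf: "(\<lambda>x. c * f x) \<in> W12"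
    by (rule hilbert_space_on_parallelogram(3)[OF hilbert assms assms])
  have "enn2real (cheeger_energy (\<lambda>x. c * f x)) = c\<^sup>2 * enn2real (cheeger_energy f)"
    using hilbert_space_on_parallelogram(5)[OF hilbert assms assms, of c]
    unfolding W12_norm_power2 L2_norm_cmult power_mult_distrib by (simp add: distrib_left)
  then have "ennreal (enn2real (cheeger_energy (\<lambda>x. c * f x))) = ennreal (c\<^sup>2) * ennreal (enn2real (cheeger_energy f))"
    by (simp only: ennreal_mult[OF zero_le_power2 enn2real_nonneg])
  then show ?thesis
    by (simp only: W12D(2)[OF cf, symmetric] W12D(2)[OF assms, symmetric])
qed

lemma cheeger_parallelogram:
  assumes "f \<in> W12" "g \<in> W12"
  shows "cheeger_energy (\<lambda>x. f x + g x) + cheeger_energy (\<lambda>x. f x - g x)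
    = 2 * cheeger_energy f + 2 * cheeger_energy g"
proof -
  note mem = hilbert_space_on_parallelogram(1,2)[OF hilbert assms]
  have "enn2real (cheeger_energy (\<lambda>x. f x + g x)) + enn2real (cheeger_energy (\<lambda>x. f x - g x))
      = 2 * enn2real (cheeger_energy f) + 2 * enn2real (cheeger_energy g)"
    using hilbert_space_on_parallelogram(4)[OF hilbert assms] L2_norm_parallelogram[OF assms[THEN W12D(1)]]
    unfolding W12_norm_power2 by argo
  then have "ennreal (enn2real (cheeger_energy (\<lambda>x. f x + g x))) + ennreal (enn2real (cheeger_energy (\<lambda>x. f x - g x)))
      = 2 * ennreal (enn2real (cheeger_energy f)) + 2 * ennreal (enn2real (cheeger_energy g))"
    by (simp add: ennreal_plus[symmetric] ennreal_mult[symmetric] ennreal_numeral[symmetric]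
        del: ennreal_plus ennreal_mult ennreal_numeral ennreal_enn2real)
  then show ?thesis
    by (simp only: W12D(2)[OF mem(1), symmetric] W12D(2)[OF mem(2), symmetric] W12D(2)[OF assms(1), symmetric]
        W12D(2)[OF assms(2), symmetric])
qed

end

locale increasing_metrics =
  D: metric_measure_space X d m for X :: "'a set" and d m +
  fixes di :: "nat \<Rightarrow> 'a \<Rightarrow> 'a \<Rightarrow> real"
  assumes mms: "\<And>i. metric_measure_space X (di i) m"
    and increasing: "\<And>i x y. x \<in> X \<Longrightarrow> y \<in> X \<Longrightarrow> di i x y \<le> di (Suc i) x y"
    and limit: "\<And>x y. x \<in> X \<Longrightarrow> y \<in> X \<Longrightarrow> (\<lambda>i. di i x y) \<longlonglongrightarrow> d x y"
    and same_topology: "\<And>i. Metric_space.mtopology X (di i) = D.mtopology"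
begin

abbreviation "energy i \<equiv> metric_measure_space.asymptotic_energy X (di i) m"
abbreviation "cheeger i \<equiv> metric_measure_space.cheeger_energy X (di i) m"

lemma di_mono: "x \<in> X \<Longrightarrow> y \<in> X \<Longrightarrow> i \<le> j \<Longrightarrow> di i x y \<le> di j x y"
  by (rule lift_Suc_mono_le[of "\<lambda>i. di i x y"]) (use increasing in auto)

lemma di_le: "x \<in> X \<Longrightarrow> y \<in> X \<Longrightarrow> di i x y \<le> d x y"
  by (rule incseq_le[OF incseq_SucI limit]) (use increasing in auto)

lemma comparable_limit: "comparable_metrics X d (di i) m"
  unfolding comparable_metrics_def comparable_metrics_axioms_def
  using D.metric_measure_space_axioms mms di_le by blast

lemma comparable_sequence: "i \<le> j \<Longrightarrow> comparable_metrics X (di j) (di i) m"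
  unfolding comparable_metrics_def comparable_metrics_axioms_def
  using mms di_mono by blast

text \<open>
  Convergence at the finitely many pairs of centres is uniform, and \<open>di i \<le> d\<close> makes every \<open>di i\<close> as
  continuous as \<open>d\<close>. Hence on balls of radius \<open>\<rho>\<close> the two distances differ by a multiple of \<open>\<rho>\<close>, however
  differently they behave at smaller scales.
\<close>

lemma uniform_on_ball_union:
  assumes Q: "finite Q" "Q \<subseteq> X" and \<rho>: "0 < \<rho>"
  shows "\<exists>i. \<forall>y\<in>(\<Union>q\<in>Q. D.mball q \<rho>). \<forall>z\<in>(\<Union>q\<in>Q. D.mball q \<rho>). d y z \<le> di i y z + 5 * \<rho>"
proof -
  have "\<forall>\<^sub>F i in sequentially. \<forall>q\<in>Q. \<forall>q'\<in>Q. d q q' - \<rho> < di i q q'"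
    using Q \<rho> by (intro eventually_ball_finite ballI order_tendstoD(1)[OF limit]) auto
  then obtain i where i: "\<And>q q'. q \<in> Q \<Longrightarrow> q' \<in> Q \<Longrightarrow> d q q' - \<rho> < di i q q'"
    by (auto simp: eventually_sequentially)
  interpret E: metric_measure_space X "di i" m by (rule mms)
  show ?thesis
  proof (intro exI[of _ i] ballI)
    fix y z assume "y \<in> (\<Union>q\<in>Q. D.mball q \<rho>)" "z \<in> (\<Union>q\<in>Q. D.mball q \<rho>)"
    then obtain q q' where q: "q \<in> Q" "q \<in> X" "y \<in> X" "d q y < \<rho>" and q': "q' \<in> Q" "q' \<in> X" "z \<in> X" "d q' z < \<rho>"
      by auto
    have "d y z \<le> d q y + d q q' + d q' z"
      using D.triangle[OF q(3,2) q'(3)] D.triangle[OF q(2) q'(2,3)] by (simp add: D.commute)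
    moreover have "di i q q' \<le> di i q y + di i y z + di i q' z"
      using E.triangle[OF q(2,3) q'(2)] E.triangle[OF q(3) q'(3,2)] by (simp add: E.commute)
    ultimately show "d y z \<le> di i y z + 5 * \<rho>"
      using i[OF q(1) q'(1)] di_le[OF q(2,3), of i] di_le[OF q'(2,3), of i] q(4) q'(4) by linarith
  qed
qed

text \<open>
  The weight of the chains is the Lipschitz constant at a positive scale; letting the scale tend to 0
  recovers the asymptotic energy.
\<close>

lemma Lip_energy_LIMSEQ:
  assumes lip: "\<And>x y. x \<in> X \<Longrightarrow> y \<in> X \<Longrightarrow> \<bar>f x - f y\<bar> \<le> L * d x y" "0 < L"
    and B: "B \<in> sets m" "emeasure m B < \<infinity>"
  shows "(\<lambda>n. \<integral>\<^sup>+x. (D.Lip f (D.mball x (1 / Suc n)) + ennreal (1 / Suc n))\<^sup>2 * indicator B x \<partial>m)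
    \<longlonglongrightarrow> (\<integral>\<^sup>+x. (D.asymptotic_slope f x)\<^sup>2 * indicator B x \<partial>m)"
proof (rule nn_integral_dominated_convergence[where w = "\<lambda>x. (ennreal (L + 1))\<^sup>2 * indicator B x"])
  have [measurable]: "(\<lambda>x. D.Lip f (D.mball x r)) \<in> borel_measurable m" for r
    by (rule D.Lip_ball_measurable)
  note [measurable] = B(1)
  show "(\<lambda>x. (D.Lip f (D.mball x (1 / Suc n)) + ennreal (1 / Suc n))\<^sup>2 * indicator B x) \<in> borel_measurable m" for n
    by measurable
  show "(\<lambda>x. (D.asymptotic_slope f x)\<^sup>2 * indicator B x) \<in> borel_measurable m"
    by measurable
  show "(\<lambda>x. (ennreal (L + 1))\<^sup>2 * indicator B x) \<in> borel_measurable m"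
    by measurable
  show "(\<integral>\<^sup>+x. (ennreal (L + 1))\<^sup>2 * indicator B x \<partial>m) < \<infinity>"
    using B by (simp add: nn_integral_cmult_indicator ennreal_mult_less_top power_less_top_ennreal)
  show "AE x in m. (D.Lip f (D.mball x (1 / Suc n)) + ennreal (1 / Suc n))\<^sup>2 * indicator B x
      \<le> (ennreal (L + 1))\<^sup>2 * indicator B x" for n
  proof (rule AE_I2)
    fix x
    have "D.Lip f (D.mball x (1 / Suc n)) \<le> ennreal L"
      by (rule D.Lip_le[OF lip(1)]) auto
    moreover have "ennreal (1 / Suc n) \<le> ennreal 1" by (rule ennreal_leI) simp
    ultimately have "D.Lip f (D.mball x (1 / Suc n)) + ennreal (1 / Suc n) \<le> ennreal L + ennreal 1"
      by (rule add_mono)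
    also have "\<dots> = ennreal (L + 1)"
      by (rule ennreal_plus[symmetric]) (use lip(2) in auto)
    finally show "(D.Lip f (D.mball x (1 / Suc n)) + ennreal (1 / Suc n))\<^sup>2 * indicator B x
      \<le> (ennreal (L + 1))\<^sup>2 * indicator B x"
      by (intro mult_right_mono power_mono) auto
  qed
  show "AE x in m. (\<lambda>n. (D.Lip f (D.mball x (1 / Suc n)) + ennreal (1 / Suc n))\<^sup>2 * indicator B x)
      \<longlonglongrightarrow> (D.asymptotic_slope f x)\<^sup>2 * indicator B x"
  proof (rule AE_I2)
    fix x
    have "(\<lambda>n. 1 / real (Suc n)) \<longlonglongrightarrow> 0" by (rule lim_inverse_n'[THEN LIMSEQ_Suc])
    then have "(\<lambda>n. ennreal (1 / real (Suc n))) \<longlonglongrightarrow> ennreal 0" by (rule tendsto_ennrealI)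
    then have lim: "(\<lambda>n. D.Lip f (D.mball x (1 / Suc n)) + ennreal (1 / Suc n)) \<longlonglongrightarrow> D.asymptotic_slope f x"
      using tendsto_add[OF D.Lip_ball_LIMSEQ] by fastforce
    have "D.asymptotic_slope f x \<le> ennreal L"
      by (rule D.slope_le[OF zero_less_one lip(1)]) auto
    then have fin: "D.asymptotic_slope f x \<noteq> top" by (auto simp: top_unique)
    have "(\<lambda>n. (D.Lip f (D.mball x (1 / Suc n)) + ennreal (1 / Suc n))\<^sup>2) \<longlonglongrightarrow> (D.asymptotic_slope f x)\<^sup>2"
      unfolding power2_eq_square using lim fin by (intro tendsto_mult_ennreal) auto
    then show "(\<lambda>n. (D.Lip f (D.mball x (1 / Suc n)) + ennreal (1 / Suc n))\<^sup>2 * indicator B x)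
      \<longlonglongrightarrow> (D.asymptotic_slope f x)\<^sup>2 * indicator B x"
      by (cases "x \<in> B") auto
  qed
qed

text \<open>
  The parameters are chosen in this order: a bounded set \<open>B\<close> that contains the supports for all indices
  at once, since it is a ball of the smallest distance \<open>di 0\<close>; the scale \<open>s\<close> and \<open>\<epsilon>\<close>, which bring the
  energy near that of \<open>f\<close>; the admissible gap \<open>\<theta>\<close> between the distances; the measure \<open>\<kappa>\<close> of
  the exceptional part of \<open>B\<close>; the balls forming \<open>S\<close>, of radius \<open>\<theta> / 5\<close>; and last the index.
\<close>

lemma asymptotic_recovery:
  assumes f: "f \<in> L2 m" and c: "0 \<le> c" "D.asymptotic_energy f \<le> ennreal c" and \<tau>: "0 < \<tau>"
  shows "\<exists>i. \<exists>F\<in>L2 m. L2_norm m (\<lambda>x. F x - f x) < \<tau> \<and> energy i F \<le> ennreal (c + \<tau>)"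
proof (cases "X = {}")
  case True
  have "energy 0 f = 0" by (rule metric_measure_space.asymptotic_energy_empty[OF mms True])
  then show ?thesis using f \<tau> by (intro exI[of _ 0] bexI[of _ f]) auto
next
  case False
  then obtain p where p: "p \<in> X" by blast
  have "D.asymptotic_energy f < \<infinity>" using c(2) by (rule le_less_trans) simp
  then obtain L R C where pos: "0 < L" "0 < R" "0 < C"
    and lip: "\<And>x y. x \<in> X \<Longrightarrow> y \<in> X \<Longrightarrow> \<bar>f x - f y\<bar> \<le> L * d x y"
    and supp: "\<And>x. x \<in> X \<Longrightarrow> R < d p x \<Longrightarrow> f x = 0"
    and bound: "\<And>x. x \<in> X \<Longrightarrow> \<bar>f x\<bar> \<le> C"
    and energy_f: "D.asymptotic_energy f = (\<integral>\<^sup>+x. (D.asymptotic_slope f x)\<^sup>2 \<partial>m) / 2"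
    using D.asymptotic_energy_finiteE[OF _ p] by metis
  interpret E0: metric_measure_space X "di 0" m by (rule mms)
  define B where "B = E0.mcball p (R + 1 + C / (4 * L))"
  have B: "B \<in> sets m" "emeasure m B < \<infinity>"
    unfolding B_def by (rule E0.mcball_sets, rule E0.emeasure_mcball_finite)
  have slope_f: "(\<integral>\<^sup>+x. (D.asymptotic_slope f x)\<^sup>2 * indicator B x \<partial>m) \<le> ennreal (2 * c)"
  proof -
    let ?I = "\<integral>\<^sup>+x. (D.asymptotic_slope f x)\<^sup>2 \<partial>m"
    have "(\<integral>\<^sup>+x. (D.asymptotic_slope f x)\<^sup>2 * indicator B x \<partial>m) \<le> ?I"
      by (rule nn_integral_mono) (auto simp: indicator_def)
    also have "?I = 2 * (?I / 2)"
      by (simp add: ennreal_times_divide mult.commute[of 2] mult_divide_eq_ennreal)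
    also have "\<dots> \<le> 2 * ennreal c" using c(2) unfolding energy_f by (intro mult_left_mono) auto
    also have "\<dots> = ennreal (2 * c)" using c(1) by (simp add: ennreal_mult)
    finally show ?thesis .
  qed
  define \<mu> where "\<mu> = measure m B"
  have \<mu>: "emeasure m B = ennreal \<mu>" "0 \<le> \<mu>"
    using B(2) by (auto simp: \<mu>_def emeasure_eq_ennreal_measure less_top)
  let ?\<phi> = "\<lambda>n. \<integral>\<^sup>+x. (D.Lip f (D.mball x (1 / Suc n)) + ennreal (1 / Suc n))\<^sup>2 * indicator B x \<partial>m"
  have inv: "(\<lambda>n. 1 / real (Suc n)) \<longlonglongrightarrow> 0" by (rule lim_inverse_n'[THEN LIMSEQ_Suc])
  have "(\<lambda>n. (L * (1 / real (Suc n)) / 4)\<^sup>2 * \<mu>) \<longlonglongrightarrow> (L * 0 / 4)\<^sup>2 * \<mu>"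
    by (intro tendsto_intros inv) auto
  then have lim2: "(\<lambda>n. (L * (1 / real (Suc n)) / 4)\<^sup>2 * \<mu>) \<longlonglongrightarrow> 0" by simp
  have "ennreal (2 * c) < ennreal (2 * c + \<tau>)" using \<tau> c by (simp add: ennreal_less_iff)
  then have "\<forall>\<^sub>F n in sequentially. ?\<phi> n < ennreal (2 * c + \<tau>)"
    using slope_f by (intro order_tendstoD(2)[OF Lip_energy_LIMSEQ[OF lip pos(1) B]]) auto
  then have "\<forall>\<^sub>F n in sequentially. ?\<phi> n < ennreal (2 * c + \<tau>) \<and> 1 / real (Suc n) < L
      \<and> (L * (1 / real (Suc n)) / 4)\<^sup>2 * \<mu> < \<tau>\<^sup>2 / 8"
    using pos \<tau> by (intro eventually_conj order_tendstoD(2)[OF inv] order_tendstoD(2)[OF lim2]) auto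
  then obtain n where n: "?\<phi> n < ennreal (2 * c + \<tau>)" "1 / real (Suc n) < L"
      "(L * (1 / real (Suc n)) / 4)\<^sup>2 * \<mu> < \<tau>\<^sup>2 / 8"
    using eventually_happens' sequentially_bot by blast
  define \<epsilon> where "\<epsilon> = 1 / real (Suc n)"
  define s where "s = \<epsilon> / 2"
  have \<epsilon>: "0 < \<epsilon>" "\<epsilon> \<le> L" and s: "0 < s" using n(2) by (auto simp: \<epsilon>_def s_def)
  define \<theta> where "\<theta> = min (s / 16) (\<epsilon> * (s / 4) / (L + \<epsilon>))"
  have \<theta>: "0 < \<theta>" "\<theta> < s / 8" "(L + \<epsilon>) * \<theta> \<le> \<epsilon> * (s / 4)"
  proof -
    show "0 < \<theta>" using s \<epsilon> pos by (simp add: \<theta>_def add_pos_pos)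
    show "\<theta> < s / 8" using s by (simp add: \<theta>_def min_less_iff_disj)
    have "(L + \<epsilon>) * \<theta> \<le> (L + \<epsilon>) * (\<epsilon> * (s / 4) / (L + \<epsilon>))"
      using pos \<epsilon> by (intro mult_left_mono) (auto simp: \<theta>_def)
    also have "\<dots> = \<epsilon> * (s / 4)"
      using nonzero_mult_div_cancel_left[of "L + \<epsilon>" "\<epsilon> * (s / 4)"] pos(1) \<epsilon>(1)
      unfolding times_divide_eq_right by linarith
    finally show "(L + \<epsilon>) * \<theta> \<le> \<epsilon> * (s / 4)" .
  qed
  \<comment> \<open>With measure at most \<open>\<kappa>\<close>, the part of \<open>B\<close> off \<open>S\<close> contributes at most \<open>\<tau>\<close> to twice the energy
     and \<open>\<tau>\<^sup>2 / 8\<close> to the squared \<open>L\<^sup>2\<close> distance.\<close>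
  define \<kappa> where "\<kappa> = min (\<tau> / (4 * L)\<^sup>2) ((\<tau>\<^sup>2 / 8) / (2 * C)\<^sup>2)"
  have \<kappa>: "0 < \<kappa>" "(4 * L)\<^sup>2 * \<kappa> \<le> \<tau>" "(2 * C)\<^sup>2 * \<kappa> \<le> \<tau>\<^sup>2 / 8"
  proof -
    show "0 < \<kappa>" using \<tau> pos by (simp add: \<kappa>_def)
    have "(4 * L)\<^sup>2 * \<kappa> \<le> (4 * L)\<^sup>2 * (\<tau> / (4 * L)\<^sup>2)" by (intro mult_left_mono) (auto simp: \<kappa>_def)
    then show "(4 * L)\<^sup>2 * \<kappa> \<le> \<tau>" using pos by simp
    have "(2 * C)\<^sup>2 * \<kappa> \<le> (2 * C)\<^sup>2 * ((\<tau>\<^sup>2 / 8) / (2 * C)\<^sup>2)" by (intro mult_left_mono) (auto simp: \<kappa>_def)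
    then show "(2 * C)\<^sup>2 * \<kappa> \<le> \<tau>\<^sup>2 / 8" using pos by simp
  qed
  obtain Q where Q: "finite Q" "Q \<subseteq> X" "emeasure m (B - (\<Union>q\<in>Q. D.mball q (\<theta> / 5))) < ennreal \<kappa>"
    using D.finite_ball_cover[OF B _ \<kappa>(1), of "\<theta> / 5"] \<theta>(1) by auto
  define S where "S = (\<Union>q\<in>Q. D.mball q (\<theta> / 5))"
  have S: "openin D.mtopology S" unfolding S_def by (intro openin_Union) auto
  have small: "emeasure m (B - S) \<le> ennreal \<kappa>" using Q(3) by (simp add: S_def)
  obtain i where i: "\<And>y z. y \<in> S \<Longrightarrow> z \<in> S \<Longrightarrow> d y z \<le> di i y z + \<theta>"
  proof -
    have "\<exists>i. \<forall>y\<in>S. \<forall>z\<in>S. d y z \<le> di i y z + 5 * (\<theta> / 5)"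
      unfolding S_def by (rule uniform_on_ball_union[OF Q(1,2)]) (use \<theta>(1) in simp)
    then show thesis using that by auto
  qed
  interpret P: comparable_metrics X d "di i" m by (rule comparable_limit)
  have BE: "P.E.mcball p (R + 1 + C / (4 * L)) \<subseteq> B"
    unfolding B_def using di_mono[OF p _ le0, of _ i] by fastforce
  from P.chain_approximation[OF same_topology p pos lip supp bound S \<epsilon> s i less_imp_le[OF \<theta>(1)] \<theta>(3,2) B(1) BE]
  obtain F where F: "F \<in> L2 m"
    and F_energy: "energy i F \<le> ((\<integral>\<^sup>+x. (D.Lip f (D.mball x (2 * s)) + ennreal \<epsilon>)\<^sup>2 * indicator B x \<partial>m)
      + ennreal ((4 * L)\<^sup>2) * emeasure m (B - S)) / 2"
    and F_diff: "(\<integral>\<^sup>+x. ennreal ((F x - f x)\<^sup>2) \<partial>m)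
      \<le> ennreal ((L * s / 2)\<^sup>2) * emeasure m B + ennreal ((2 * C)\<^sup>2) * emeasure m (B - S)"
    by blast
  have "energy i F \<le> ennreal (c + \<tau>)"
  proof -
    have "ennreal ((4 * L)\<^sup>2) * emeasure m (B - S) \<le> ennreal ((4 * L)\<^sup>2) * ennreal \<kappa>"
      by (intro mult_left_mono small) simp
    also have "\<dots> = ennreal ((4 * L)\<^sup>2 * \<kappa>)" using \<kappa>(1) by (subst ennreal_mult) auto
    also have "\<dots> \<le> ennreal \<tau>" by (rule ennreal_leI[OF \<kappa>(2)])
    finally have 1: "ennreal ((4 * L)\<^sup>2) * emeasure m (B - S) \<le> ennreal \<tau>" .
    have 2: "(\<integral>\<^sup>+x. (D.Lip f (D.mball x (2 * s)) + ennreal \<epsilon>)\<^sup>2 * indicator B x \<partial>m) \<le> ennreal (2 * c + \<tau>)"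
      using n(1) by (simp add: s_def \<epsilon>_def del: of_nat_Suc)
    have "energy i F \<le> (ennreal (2 * c + \<tau>) + ennreal \<tau>) / 2"
      by (rule order_trans[OF F_energy]) (intro divide_right_mono_ennreal add_mono 1 2)
    also have "\<dots> = ennreal (2 * c + \<tau> + \<tau>) / ennreal 2"
      using c(1) \<tau> by (simp add: ennreal_plus[symmetric] del: ennreal_plus)
    also have "\<dots> = ennreal ((2 * c + \<tau> + \<tau>) / 2)"
      using c(1) \<tau> by (intro divide_ennreal) auto
    also have "(2 * c + \<tau> + \<tau>) / 2 = c + \<tau>" by simp
    finally show ?thesis .
  qed
  moreover have "L2_norm m (\<lambda>x. F x - f x) < \<tau>"
  proof -
    have "ennreal ((2 * C)\<^sup>2) * emeasure m (B - S) \<le> ennreal ((2 * C)\<^sup>2) * ennreal \<kappa>"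
      by (intro mult_left_mono small) simp
    also have "\<dots> = ennreal ((2 * C)\<^sup>2 * \<kappa>)" using \<kappa>(1) by (subst ennreal_mult) auto
    also have "\<dots> \<le> ennreal (\<tau>\<^sup>2 / 8)" by (rule ennreal_leI[OF \<kappa>(3)])
    finally have 1: "ennreal ((2 * C)\<^sup>2) * emeasure m (B - S) \<le> ennreal (\<tau>\<^sup>2 / 8)" .
    have "ennreal ((L * s / 2)\<^sup>2) * emeasure m B = ennreal ((L * s / 2)\<^sup>2 * \<mu>)"
      unfolding \<mu>(1) by (rule ennreal_mult[symmetric]) (use \<mu>(2) in auto)
    also have "\<dots> \<le> ennreal (\<tau>\<^sup>2 / 8)"
    proof -
      have "L * s / 2 = L * (1 / real (Suc n)) / 4" by (simp add: s_def \<epsilon>_def)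
      then show ?thesis using n(3) by (intro ennreal_leI) (simp only: less_imp_le)
    qed
    finally have 2: "ennreal ((L * s / 2)\<^sup>2) * emeasure m B \<le> ennreal (\<tau>\<^sup>2 / 8)" .
    have "(\<integral>\<^sup>+x. ennreal ((F x - f x)\<^sup>2) \<partial>m) \<le> ennreal (\<tau>\<^sup>2 / 8) + ennreal (\<tau>\<^sup>2 / 8)"
      by (rule order_trans[OF F_diff add_mono[OF 2 1]])
    also have "\<dots> = ennreal ((\<tau> / 2)\<^sup>2)"
      by (simp add: power_divide flip: ennreal_plus)
    finally have "L2_norm m (\<lambda>x. F x - f x) \<le> \<tau> / 2"
      using \<tau> L2_measurable[OF L2_diff[OF F f]] by (intro L2_I_nn_integral(2)) auto
    then show ?thesis using \<tau> by simp
  qed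
  ultimately show ?thesis using F by blast
qed

text \<open>
  The bound holds for all later indices because the energies decrease in the index.
\<close>

lemma cheeger_recovery:
  assumes f: "f \<in> L2 m" and c: "0 \<le> c" "D.cheeger_energy f \<le> ennreal c" and \<tau>: "0 < \<tau>"
  shows "\<exists>i. \<exists>g\<in>L2 m. L2_norm m (\<lambda>x. g x - f x) < \<tau> \<and> (\<forall>j\<ge>i. cheeger j g \<le> ennreal (c + \<tau>))"
proof -
  obtain G where G: "G \<in> L2 m" "L2_norm m (\<lambda>x. G x - f x) < \<tau> / 4" "D.asymptotic_energy G \<le> ennreal (c + \<tau> / 4)"
    using D.cheeger_approx[OF c(2,1), of "\<tau> / 4"] \<tau> by auto
  obtain i F where F: "F \<in> L2 m" "L2_norm m (\<lambda>x. F x - G x) < \<tau> / 4" "energy i F \<le> ennreal (c + \<tau> / 4 + \<tau> / 4)"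
    using asymptotic_recovery[OF G(1) _ G(3), of "\<tau> / 4"] c(1) \<tau> by auto
  have norm: "L2_norm m (\<lambda>x. F x - f x) < \<tau>"
    using L2_norm_triangle[OF F(1) G(1) f] F(2) G(2) by simp
  have "cheeger j F \<le> ennreal (c + \<tau>)" if "i \<le> j" for j
  proof -
    interpret P: comparable_metrics X "di j" "di i" m by (rule comparable_sequence[OF that])
    have "cheeger j F \<le> ennreal (c + \<tau> / 4 + \<tau> / 4)"
      by (rule P.cheeger_le_asymptotic_energy[OF F(1) _ F(3)]) (use c(1) \<tau> in simp)
    also have "\<dots> \<le> ennreal (c + \<tau>)" using \<tau> by (intro ennreal_leI) simp
    finally show ?thesis .
  qed
  with norm F(1) show ?thesis by blast
qed

lemma cheeger_le: "f \<in> L2 m \<Longrightarrow> D.cheeger_energy f \<le> cheeger i f"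
  by (rule comparable_metrics.cheeger_mono[OF comparable_limit])

end

theorem corollary4p2:
  fixes X :: "'a set" and d :: "'a \<Rightarrow> 'a \<Rightarrow> real" and m :: "'a measure"
    and di :: "nat \<Rightarrow> 'a \<Rightarrow> 'a \<Rightarrow> real"
  assumes "metric_measure_space X d m"
    and "\<And>i. Metric_space X (di i)"
    and "\<And>i. Metric_space.mcomplete X (di i)"
    and "\<And>i x y. x \<in> X \<Longrightarrow> y \<in> X \<Longrightarrow> di i x y \<le> di (Suc i) x y"
    and "\<And>x y. x \<in> X \<Longrightarrow> y \<in> X \<Longrightarrow> (\<lambda>i. di i x y) \<longlonglongrightarrow> d x y"
    and "\<And>i. Metric_space.mtopology X (di i) = Metric_space.mtopology X d"
    and "\<And>i. infinitesimally_hilbertian X (di i) m"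
  shows "infinitesimally_hilbertian X d m"
proof -
  interpret D: metric_measure_space X d m by fact
  interpret increasing_metrics X d m di
    by (intro increasing_metrics.intro increasing_metrics_axioms.intro
        infinitesimally_hilbertian.axioms(1) assms)
  have hom: "D.cheeger_energy (\<lambda>x. k * f x) \<le> ennreal (k\<^sup>2) * D.cheeger_energy f" if f: "f \<in> D.W12" for k f
  proof -
    define a where "a = enn2real (D.cheeger_energy f)"
    have a: "D.cheeger_energy f = ennreal a" "0 \<le> a" using D.W12D(2)[OF f] by (simp_all add: a_def)
    note fL = D.W12D(1)[OF f]
    have "D.cheeger_energy (\<lambda>x. k * f x) \<le> ennreal (k\<^sup>2 * a)"
    proof (rule D.cheeger_lsc[OF L2_cmult[OF fL]])
      fix e :: real assume e: "0 < e"
      \<comment> \<open>Small enough for the error in norm, \<open>\<bar>k\<bar> * \<tau>\<close>, and for that in energy, \<open>k\<^sup>2 * \<tau>\<close>.\<close>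
      define \<tau> where "\<tau> = e / (1 + \<bar>k\<bar> + k\<^sup>2)"
      have den: "0 < 1 + \<bar>k\<bar> + k\<^sup>2" by (simp add: add_pos_nonneg)
      have \<tau>: "0 < \<tau>" using e den by (simp add: \<tau>_def)
      have "(1 + \<bar>k\<bar> + k\<^sup>2) * \<tau> = e" using den by (simp add: \<tau>_def)
      then have sum: "\<tau> + \<bar>k\<bar> * \<tau> + k\<^sup>2 * \<tau> = e" by (simp add: algebra_simps)
      have nn: "0 \<le> \<bar>k\<bar> * \<tau>" "0 \<le> k\<^sup>2 * \<tau>" using \<tau> by auto
      obtain i g where g: "g \<in> L2 m" "L2_norm m (\<lambda>x. g x - f x) < \<tau>" "cheeger i g \<le> ennreal (a + \<tau>)"
        using cheeger_recovery[OF fL a(2) eq_refl[OF a(1)] \<tau>] by blast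
      interpret H: infinitesimally_hilbertian X "di i" m by (rule assms(7))
      have gW: "g \<in> H.W12" by (rule H.W12I[OF g(1,3)])
      have "D.cheeger_energy (\<lambda>x. k * g x) \<le> cheeger i (\<lambda>x. k * g x)"
        by (rule cheeger_le[OF L2_cmult[OF g(1)]])
      also have "\<dots> \<le> ennreal (k\<^sup>2) * ennreal (a + \<tau>)"
        unfolding H.cheeger_cmult[OF gW] by (intro mult_left_mono g(3)) simp
      also have "\<dots> = ennreal (k\<^sup>2 * (a + \<tau>))" by (rule ennreal_mult[symmetric]) (use a \<tau> in auto)
      also have "\<dots> \<le> ennreal (k\<^sup>2 * a + e)"
        using sum nn \<tau> by (intro ennreal_leI) (unfold distrib_left, linarith)
      finally have "D.cheeger_energy (\<lambda>x. k * g x) \<le> ennreal (k\<^sup>2 * a + e)" .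
      moreover have "L2_norm m (\<lambda>x. k * g x - k * f x) < e"
      proof -
        have "L2_norm m (\<lambda>x. k * g x - k * f x) = \<bar>k\<bar> * L2_norm m (\<lambda>x. g x - f x)"
          by (simp only: right_diff_distrib[symmetric] L2_norm_cmult)
        also have "\<dots> \<le> \<bar>k\<bar> * \<tau>" using g(2) by (intro mult_left_mono) auto
        finally show ?thesis using sum nn \<tau> by linarith
      qed
      ultimately show "\<exists>g\<in>L2 m. L2_norm m (\<lambda>x. g x - k * f x) < e \<and> D.cheeger_energy g \<le> ennreal (k\<^sup>2 * a + e)"
        using L2_cmult[OF g(1), of k] by (intro bexI[of _ "\<lambda>x. k * g x"] conjI)
    qed (use a in simp)
    then show ?thesis using a by (simp add: ennreal_mult)
  qed
  have par: "D.cheeger_energy (\<lambda>x. f x + g x) + D.cheeger_energy (\<lambda>x. f x - g x)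
      \<le> 2 * D.cheeger_energy f + 2 * D.cheeger_energy g" if f: "f \<in> D.W12" and g: "g \<in> D.W12" for f g
  proof -
    define a b where "a = enn2real (D.cheeger_energy f)" and "b = enn2real (D.cheeger_energy g)"
    have a: "D.cheeger_energy f = ennreal a" "0 \<le> a" using D.W12D(2)[OF f] by (simp_all add: a_def)
    have b: "D.cheeger_energy g = ennreal b" "0 \<le> b" using D.W12D(2)[OF g] by (simp_all add: b_def)
    note fL = D.W12D(1)[OF f] and gL = D.W12D(1)[OF g]
    have "D.cheeger_energy (\<lambda>x. f x + g x) + D.cheeger_energy (\<lambda>x. f x - g x) \<le> ennreal (2 * a + 2 * b)"
    proof (rule D.cheeger_lsc_pair[OF L2_add[OF fL gL] L2_diff[OF fL gL]])
      fix e :: real assume e: "0 < e"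
      then have \<tau>: "0 < e / 4" by simp
      obtain i u where u: "u \<in> L2 m" "L2_norm m (\<lambda>x. u x - f x) < e / 4" "\<And>j. j \<ge> i \<Longrightarrow> cheeger j u \<le> ennreal (a + e / 4)"
        using cheeger_recovery[OF fL a(2) eq_refl[OF a(1)] \<tau>] by blast
      obtain j v where v: "v \<in> L2 m" "L2_norm m (\<lambda>x. v x - g x) < e / 4" "\<And>l. l \<ge> j \<Longrightarrow> cheeger l v \<le> ennreal (b + e / 4)"
        using cheeger_recovery[OF gL b(2) eq_refl[OF b(1)] \<tau>] by blast
      define l where "l = max i j"
      interpret H: infinitesimally_hilbertian X "di l" m by (rule assms(7))
      have ul: "cheeger l u \<le> ennreal (a + e / 4)" and vl: "cheeger l v \<le> ennreal (b + e / 4)"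
        using u(3)[of l] v(3)[of l] by (simp_all add: l_def)
      have W: "u \<in> H.W12" "v \<in> H.W12" by (rule H.W12I[OF u(1) ul], rule H.W12I[OF v(1) vl])
      have "D.cheeger_energy (\<lambda>x. u x + v x) + D.cheeger_energy (\<lambda>x. u x - v x)
          \<le> cheeger l (\<lambda>x. u x + v x) + cheeger l (\<lambda>x. u x - v x)"
        by (intro add_mono cheeger_le L2_add L2_diff u(1) v(1))
      also have "\<dots> = 2 * cheeger l u + 2 * cheeger l v" by (rule H.cheeger_parallelogram[OF W])
      also have "\<dots> \<le> 2 * ennreal (a + e / 4) + 2 * ennreal (b + e / 4)"
        by (intro add_mono mult_left_mono ul vl) auto
      also have "\<dots> = ennreal (2 * (a + e / 4) + 2 * (b + e / 4))"
      proof -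
        have dist: "2 * ennreal x + 2 * ennreal y = ennreal (2 * x + 2 * y)" if "0 \<le> x" "0 \<le> y" for x y
          using that by (simp add: ennreal_mult)
        show ?thesis by (rule dist) (use a(2) b(2) e in auto)
      qed
      also have "2 * (a + e / 4) + 2 * (b + e / 4) = 2 * a + 2 * b + e" by simp
      finally have sum: "D.cheeger_energy (\<lambda>x. u x + v x) + D.cheeger_energy (\<lambda>x. u x - v x) \<le> ennreal (2 * a + 2 * b + e)" .
      have "L2_norm m (\<lambda>x. (u x - f x) + (v x - g x)) < e"
        using L2_norm_add_le[OF L2_diff[OF u(1) fL] L2_diff[OF v(1) gL]] u(2) v(2) by argo
      then have n1: "L2_norm m (\<lambda>x. u x + v x - (f x + g x)) < e" by (simp add: algebra_simps)
      have "L2_norm m (\<lambda>x. (u x - f x) + (g x - v x)) < e"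
        using L2_norm_add_le[OF L2_diff[OF u(1) fL] L2_diff[OF gL v(1)]] u(2) v(2)
        by (simp add: L2_norm_minus_commute[of m g v])
      then have n2: "L2_norm m (\<lambda>x. u x - v x - (f x - g x)) < e" by (simp add: algebra_simps)
      show "\<exists>f'\<in>L2 m. \<exists>g'\<in>L2 m. L2_norm m (\<lambda>x. f' x - (f x + g x)) < e \<and>
          L2_norm m (\<lambda>x. g' x - (f x - g x)) < e \<and>
          D.cheeger_energy f' + D.cheeger_energy g' \<le> ennreal (2 * a + 2 * b + e)"
        using sum n1 n2 L2_add[OF u(1) v(1)] L2_diff[OF u(1) v(1)]
        by (intro bexI[of _ "\<lambda>x. u x + v x"] bexI[of _ "\<lambda>x. u x - v x"] conjI)
    qed (use a b in simp)
    then show ?thesis using a b by (simp add: ennreal_mult)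
  qed
  show ?thesis
    by unfold_locales (rule D.hilbert_space_W12[OF hom par])
qed

end
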